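(* Let $k$ be a field of characteristic $0$, $n\ge1$, $P=k((x_1))\dots((x_n))((\partial_1^{-1}))\dots((\partial_n^{-1}))$. For $l\in\mathbf Z_{\ge0}^n$ define $H_l:P^n\to k$ by $H_l(L)=\mathrm{res}_P(L_1^{l_1}\cdots L_n^{l_n})$. Then, for every $l\in\mathbf Z^n_{\ge 0}$, the function $H_l$ is an integral of motion on the manifold $P^n$ for the system $$\frac{\partial L_i}{\partial t_m}=[(L_1^{m_1}\cdots L_n^{m_n})_+,L_i],\qquad i=1,\dots,n,\quad m\in\mathbf Z_{\ge0}^n .$$
   Context: For an associative ring $A$ with a derivation $d$, $A((\partial^{-1}))$ is the left $A$-module of formal expressions $\sum_{i\le N}a_i\partial^i$ ($a_i\in A$, $N\in\mathbf{Z}$) with multiplication $(\sum_i a_i\partial^i)(\sum_j b_j\partial^j)=\sum_{i,j;\,l\ge0}\binom{i}{l}a_id^l(b_j)\partial^{i+j-l}$. The ring $P$ is obtained by iterating this construction $n$ times, starting from the field of iterated Laurent series $k((x_1))\dots((x_n))$; at the $i$-th step $\partial_i^{-1}$ is adjoined using the derivation $\partial/\partial x_i$ acting on coefficients (and killing $\partial_1,\dots,\partial_{i-1}$). For $L=\sum_{i\le N}a_i\partial_n^i\in P$ (the $a_i$ being operators in $\partial_1,\dots,\partial_{n-1}$) put $L_+=\sum_{i\ge0}a_i\partial_n^i$. $[A,B]=AB-BA$. $\mathrm{res}_P(L)\in k$ is the coefficient of $L$ at $x_1^{-1}\cdots x_n^{-1}\partial_1^{-1}\cdots\partial_n^{-1}$.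 That a function $H$ on $P^n$ is an integral of motion of the system means $\partial H/\partial t_m=0$ for all $m$, i.e. at every point $L\in P^n$ the derivative of $H$ along the vector $V^m_L=([(L_1^{m_1}\cdots L_n^{m_n})_+,L_i])_{i=1,\dots,n}$, $\frac{d}{d\epsilon}H(L+\epsilon V^m_L)|_{\epsilon=0}$, is zero. *)

theory Defs
  imports "HOL-Algebra.Ring" "HOL-Computational_Algebra.Polynomial" "HOL-Library.FuncSet"
begin

text \<open>
  All rings of the tower live on one type: a formal series is its coefficient function, which
  maps an exponent vector for the symbols \<open>x\<^sub>1, x\<^sub>2, \<dots>, \<partial>\<^sub>1, \<partial>\<^sub>2, \<dots>\<close> to an element of \<open>k\<close>.
  The coefficient of \<open>x\<^sup>a \<partial>\<^sup>b\<close> refers to the normal form with the \<open>x\<close>'s on the left of the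
  \<open>\<partial>\<close>'s. Which series are admitted, and how they are multiplied, is determined one symbol at a
  time by the ring constructions below.
\<close>

datatype symb = Xvar nat | Dvar nat

type_synonym 'k series = "(symb \<Rightarrow> int) \<Rightarrow> 'k"

text \<open>
  The coefficient \<open>a\<^sub>i\<close> of \<open>f = \<Sum>\<^sub>i a\<^sub>i v\<^sup>i\<close>, as a series in which \<open>v\<close> does not occur. Conversely
  \<open>f e = coeff_at v (e v) f (e(v := 0))\<close>.
\<close>

definition coeff_at :: "symb \<Rightarrow> int \<Rightarrow> 'k::zero series \<Rightarrow> 'k series" where
  "coeff_at v i f = (\<lambda>e. if e v = 0 then f (e(v := i)) else 0)"

definition zero_series :: "'k::zero series" where
  "zero_series = (\<lambda>_. 0)"

definition one_series :: "'k::zero_neq_one series" where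
  "one_series = (\<lambda>e. if e = (\<lambda>_. 0) then 1 else 0)"

definition add_series :: "'k::plus series \<Rightarrow> 'k series \<Rightarrow> 'k series" where
  "add_series f g = (\<lambda>e. f e + g e)"

definition scale_series :: "'k::times \<Rightarrow> 'k series \<Rightarrow> 'k series" where
  "scale_series c f = (\<lambda>e. c * f e)"

definition const_ring :: "'k::field_char_0 series ring" where
  "const_ring =
    \<lparr>carrier = {f. \<forall>e. e \<noteq> (\<lambda>_. 0) \<longrightarrow> f e = 0},
     monoid.mult = (\<lambda>f g e. if e = (\<lambda>_. 0) then f e * g e else 0),
     one = one_series, zero = zero_series, add = add_series\<rparr>"

text \<open>
  \<open>A((v))\<close>, with a commuting variable \<open>v\<close>. The index set of the sum is finite because both factors
  have only finitely many negative powers of \<open>v\<close>.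
\<close>

definition laurent_ring :: "symb \<Rightarrow> 'k::field_char_0 series ring \<Rightarrow> 'k series ring" where
  "laurent_ring v A =
    \<lparr>carrier = {f. (\<forall>i. coeff_at v i f \<in> carrier A) \<and>
                  (\<exists>N. \<forall>i<N. coeff_at v i f = zero_series)},
     monoid.mult = (\<lambda>f g e.
       \<Sum>(i, j) \<in> {(i, j). coeff_at v i f \<noteq> zero_series \<and> coeff_at v j g \<noteq> zero_series \<and>
                        i + j = e v}.
         (coeff_at v i f \<otimes>\<^bsub>A\<^esub> coeff_at v j g) (e(v := 0))),
     one = one_series, zero = zero_series, add = add_series\<rparr>"

text \<open>
  \<open>A((\<partial>\<^sup>-\<^sup>1))\<close> for a derivation \<open>d\<close> of \<open>A\<close>, where \<open>v\<close> is the symbol \<open>\<partial>\<close>. The coefficient of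
  \<open>\<partial>\<^sup>m\<close> in a product collects the terms \<open>(i choose l) a\<^sub>i d\<^sup>l(b\<^sub>j)\<close> with \<open>i + j - l = m\<close>, so
  that \<open>l = i + j - m\<close> is determined by \<open>i\<close> and \<open>j\<close>; the index set is finite because the exponents
  occurring in either factor are bounded above.
\<close>

definition pseudodiff_ring ::
  "symb \<Rightarrow> ('k series \<Rightarrow> 'k series) \<Rightarrow> 'k::field_char_0 series ring \<Rightarrow> 'k series ring" where
  "pseudodiff_ring v d A =
    \<lparr>carrier = {f. (\<forall>i. coeff_at v i f \<in> carrier A) \<and>
                  (\<exists>N. \<forall>i>N. coeff_at v i f = zero_series)},
     monoid.mult = (\<lambda>f g e.
       \<Sum>(i, j) \<in> {(i, j). coeff_at v i f \<noteq> zero_series \<and> coeff_at v j g \<noteq> zero_series \<and>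
                        i + j \<ge> e v}.
         let l = nat (i + j - e v) in
           (of_int i gchoose l) *
           (coeff_at v i f \<otimes>\<^bsub>A\<^esub> (d ^^ l) (coeff_at v j g)) (e(v := 0))),
     one = one_series, zero = zero_series, add = add_series\<rparr>"

text \<open>\<open>\<partial>/\<partial>x\<^sub>j\<close>, acting on the coefficients of monomials in the \<open>\<partial>\<^sub>i\<close>.\<close>

definition partial_x :: "nat \<Rightarrow> 'k::field_char_0 series \<Rightarrow> 'k series" where
  "partial_x j f = (\<lambda>e. of_int (e (Xvar j) + 1) * f (e(Xvar j := e (Xvar j) + 1)))"

text \<open>\<open>k((x\<^sub>1))\<dots>((x\<^sub>j))\<close>\<close>

primrec laurent_tower :: "nat \<Rightarrow> 'k::field_char_0 series ring" where
  "laurent_tower 0 = const_ring"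
| "laurent_tower (Suc j) = laurent_ring (Xvar (Suc j)) (laurent_tower j)"

text \<open>\<open>k((x\<^sub>1))\<dots>((x\<^sub>n))((\<partial>\<^sub>1\<^sup>-\<^sup>1))\<dots>((\<partial>\<^sub>j\<^sup>-\<^sup>1))\<close>\<close>

primrec pseudodiff_tower :: "nat \<Rightarrow> nat \<Rightarrow> 'k::field_char_0 series ring" where
  "pseudodiff_tower n 0 = laurent_tower n"
| "pseudodiff_tower n (Suc j) =
    pseudodiff_ring (Dvar (Suc j)) (partial_x (Suc j)) (pseudodiff_tower n j)"

definition PDO :: "nat \<Rightarrow> 'k::field_char_0 series ring" where
  "PDO n = pseudodiff_tower n n"

definition PDO_tuples :: "nat \<Rightarrow> (nat \<Rightarrow> 'k::field_char_0 series) set" where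
  "PDO_tuples n = {1..n} \<rightarrow>\<^sub>E carrier (PDO n)"

definition plus_part :: "nat \<Rightarrow> 'k::zero series \<Rightarrow> 'k series" where
  "plus_part n L = (\<lambda>e. if e (Dvar n) \<ge> 0 then L e else 0)"

definition res :: "nat \<Rightarrow> 'k series \<Rightarrow> 'k" where
  "res n L = L (\<lambda>v. if v \<in> Xvar ` {1..n} \<union> Dvar ` {1..n} then -1 else 0)"

definition commutator :: "('a, 'b) ring_scheme \<Rightarrow> 'a \<Rightarrow> 'a \<Rightarrow> 'a" where
  "commutator R A B = A \<otimes>\<^bsub>R\<^esub> B \<ominus>\<^bsub>R\<^esub> B \<otimes>\<^bsub>R\<^esub> A"

text \<open>\<open>L\<^sub>1^m\<^sub>1 \<cdots> L\<^sub>j^m\<^sub>j\<close>, in this order (the \<open>L\<^sub>i\<close> need not commute).\<close>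

primrec ordered_monomial ::
  "('a, 'b) ring_scheme \<Rightarrow> (nat \<Rightarrow> 'a) \<Rightarrow> (nat \<Rightarrow> nat) \<Rightarrow> nat \<Rightarrow> 'a" where
  "ordered_monomial R L m 0 = \<one>\<^bsub>R\<^esub>"
| "ordered_monomial R L m (Suc j) =
    ordered_monomial R L m j \<otimes>\<^bsub>R\<^esub> (L (Suc j) [^]\<^bsub>R\<^esub> m (Suc j))"

definition hamiltonian ::
  "nat \<Rightarrow> (nat \<Rightarrow> nat) \<Rightarrow> (nat \<Rightarrow> 'k::field_char_0 series) \<Rightarrow> 'k" where
  "hamiltonian n l L = res n (ordered_monomial (PDO n) L l n)"

definition flow_field ::
  "nat \<Rightarrow> (nat \<Rightarrow> nat) \<Rightarrow> (nat \<Rightarrow> 'k::field_char_0 series) \<Rightarrow> nat \<Rightarrow> 'k series" where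
  "flow_field n m L =
    (\<lambda>i\<in>{1..n}. commutator (PDO n) (plus_part n (ordered_monomial (PDO n) L m n)) (L i))"

text \<open>
  \<open>d/d\<epsilon> H(L + \<epsilon>V)\<close> at \<open>\<epsilon> = 0\<close> equals \<open>c\<close>. Over an arbitrary field the derivative is the formal
  one: the restriction of \<open>H\<close> to the line \<open>L + \<epsilon>V\<close> has to be a polynomial in \<open>\<epsilon>\<close>. That polynomial
  is unique because a field of characteristic \<open>0\<close> is infinite.
\<close>

definition has_derivative_along ::
  "nat \<Rightarrow> ((nat \<Rightarrow> 'k::field_char_0 series) \<Rightarrow> 'k) \<Rightarrow>
    (nat \<Rightarrow> 'k series) \<Rightarrow> (nat \<Rightarrow> 'k series) \<Rightarrow> 'k \<Rightarrow> bool" where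
  "has_derivative_along n H L V c \<longleftrightarrow>
    (\<exists>p :: 'k poly.
      (\<forall>\<epsilon>. H (\<lambda>i\<in>{1..n}. L i \<oplus>\<^bsub>PDO n\<^esub> scale_series \<epsilon> (V i)) = poly p \<epsilon>) \<and>
      poly (pderiv p) 0 = c)"

text \<open>Of the multi-index \<open>m\<close> only the entries \<open>m 1, \<dots>, m n\<close> matter.\<close>

definition integral_of_motion ::
  "nat \<Rightarrow> ((nat \<Rightarrow> 'k::field_char_0 series) \<Rightarrow> 'k) \<Rightarrow> bool" where
  "integral_of_motion n H \<longleftrightarrow>
    (\<forall>m :: nat \<Rightarrow> nat. \<forall>L \<in> PDO_tuples n. has_derivative_along n H L (flow_field n m L) 0)"

end

theory Submission
  imports Defs "HOL-Library.Function_Algebras" "HOL-Computational_Algebra.Formal_Power_Series"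
begin

text \<open>
  The flow moves every \<open>L\<^sub>i\<close> by the commutator with one and the same operator
  \<open>B = (L\<^sub>1^m\<^sub>1 \<cdots> L\<^sub>n^m\<^sub>n)\<^sub>+\<close>. Since \<open>[B, -]\<close> is a derivation of \<open>P\<close>, the product rule shows that
  \<open>M = L\<^sub>1^l\<^sub>1 \<cdots> L\<^sub>n^l\<^sub>n\<close> moves by \<open>[B, M]\<close>, so that \<open>H\<^sub>l\<close> changes at the rate
  \<open>res\<^sub>P [B, M]\<close>; the calculus behind this is formal, with polynomials in \<open>\<epsilon>\<close>
  (\<open>polynomial_curve_mult\<close>, \<open>lax_curve_mult\<close>). The theorem follows once \<open>P\<close> is known to be an
  associative \<open>k\<close>-algebra and \<open>res\<^sub>P\<close> to be a trace on it (\<open>tower_res_trace\<close>).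

  The residue is a trace by induction along the tower (\<open>trace_extension\<close>). Suppose that \<open>\<tau>\<close> is a
  linear form on \<open>A\<close> which vanishes on commutators and on the image of the derivation \<open>d\<close>. The
  coefficient of \<open>\<partial>\<^sup>-\<^sup>1\<close> in \<open>(a \<partial>\<^sup>i)(b \<partial>\<^sup>j)\<close> is \<open>(i choose l) a d\<^sup>l(b)\<close> with \<open>l = i + j + 1\<close>, and in
  \<open>(b \<partial>\<^sup>j)(a \<partial>\<^sup>i)\<close> it is \<open>(j choose l) b d\<^sup>l(a)\<close> with the same \<open>l\<close>. Integrating by parts \<open>l\<close> times
  gives \<open>\<tau>(b d\<^sup>l(a)) = (-1)\<^sup>l \<tau>(a d\<^sup>l(b))\<close>, and \<open>(j choose l) = (-1)\<^sup>l (i choose l)\<close> because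
  \<open>j = l - 1 - i\<close>; the two values of \<open>\<tau>\<close> agree. At the bottom of the tower the ring of iterated
  Laurent series is commutative, and at every level the residue kills every \<open>\<partial>f/\<partial>x\<^sub>j\<close>, since no
  power of \<open>x\<^sub>j\<close> has \<open>x\<^sub>j\<^sup>-\<^sup>1\<close> as its derivative.

  That \<open>P\<close> is an associative algebra is shown one symbol at a time
  (\<open>pseudodiff_series_algebra\<close>). The coefficients of a product are finite sums, so associativity
  is an identity between coefficients of \<open>a \<otimes> d\<^sup>l(b) \<otimes> d\<^sup>m(c)\<close>, and it comes down to the
  Leibniz rule and Vandermonde's identity (\<open>monomial_assoc\<close>). Replacing \<open>v\<close> by \<open>v\<^sup>-\<^sup>1\<close> turns
  \<open>A((v))\<close> into \<open>A((\<partial>\<^sup>-\<^sup>1))\<close> for the zero derivation, which settles the Laurent steps as well.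
\<close>

section \<open>Series as vectors over the coefficient field\<close>

text \<open>
  Addition of series is pointwise, so it is the addition of the function type. This makes the
  ordinary finite sums available in every ring of the tower, whatever its carrier.
\<close>

notation scale_series (infixr "\<cdot>" 76)

lemma zero_series_eq: "zero_series = 0"
  by (simp add: zero_series_def zero_fun_def)

lemma add_series_eq: "add_series = (+)"
  by (simp add: add_series_def plus_fun_def fun_eq_iff)

text \<open>
  Series stay opaque to simplification; evaluation at an exponent vector is requested explicitly
  by \<open>series_apply\<close>.
\<close>

declare plus_fun_apply [simp del] zero_fun_apply [simp del]

lemma scale_series_apply: "(c \<cdot> f) e = c * f e"
  by (simp add: scale_series_def)

lemma sum_series_apply:
  fixes F :: "'i \<Rightarrow> 'e \<Rightarrow> 'k::comm_monoid_add"
  shows "(\<Sum>i\<in>I. F i) e = (\<Sum>i\<in>I. F i e)"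
  by (induction I rule: infinite_finite_induct) (auto simp: zero_fun_apply plus_fun_apply)

lemmas series_apply = zero_fun_apply plus_fun_apply scale_series_apply sum_series_apply

lemma scale_series_simps [simp]:
  fixes f :: "'k::field_char_0 series"
  shows "0 \<cdot> f = 0" "1 \<cdot> f = f" "c \<cdot> (0::'k series) = 0" "a \<cdot> b \<cdot> f = (a * b) \<cdot> f" "- 1 \<cdot> f = - f"
  by (simp_all add: fun_eq_iff series_apply)

lemma scale_series_add: "c \<cdot> (f + g) = c \<cdot> f + c \<cdot> g" for f g :: "'k::field_char_0 series"
  by (simp add: fun_eq_iff series_apply algebra_simps)

lemma scale_series_sum: "c \<cdot> (\<Sum>i\<in>I. F i) = (\<Sum>i\<in>I. c \<cdot> F i)"
  for F :: "'i \<Rightarrow> 'k::field_char_0 series"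
  by (simp add: fun_eq_iff series_apply sum_distrib_left)

lemma sum_scale_series: "(\<Sum>i\<in>I. c i \<cdot> f) = (\<Sum>i\<in>I. c i) \<cdot> f"
  for f :: "'k::field_char_0 series"
  by (simp add: fun_eq_iff series_apply sum_distrib_right)

section \<open>Algebras of series and their derivations\<close>

text \<open>
  The structure that is carried along the tower: an associative unital \<open>k\<close>-algebra of series in
  which only the symbols from \<open>S\<close> occur. The last axiom makes it possible to adjoin a symbol
  \<open>v \<notin> S\<close>, because a coefficient of a power of \<open>v\<close> has to be free of \<open>v\<close>.
\<close>

locale series_algebra =
  fixes A :: "'k::field_char_0 series ring" (structure) and S :: "symb set"
  assumes add_eq: "add A = add_series"
    and zero_eq: "\<zero> = zero_series"
    and one_eq: "\<one> = one_series"
    and zero_closed [simp, intro]: "0 \<in> carrier A"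
    and one_closed [simp, intro]: "one_series \<in> carrier A"
    and add_closed [simp, intro]: "\<lbrakk>f \<in> carrier A; g \<in> carrier A\<rbrakk> \<Longrightarrow> f + g \<in> carrier A"
    and scale_closed [simp, intro]: "f \<in> carrier A \<Longrightarrow> c \<cdot> f \<in> carrier A"
    and mult_closed [simp, intro]: "\<lbrakk>f \<in> carrier A; g \<in> carrier A\<rbrakk> \<Longrightarrow> f \<otimes> g \<in> carrier A"
    and mult_assoc: "\<lbrakk>f \<in> carrier A; g \<in> carrier A; h \<in> carrier A\<rbrakk> \<Longrightarrow> f \<otimes> g \<otimes> h = f \<otimes> (g \<otimes> h)"
    and one_mult [simp]: "f \<in> carrier A \<Longrightarrow> one_series \<otimes> f = f"
    and mult_one [simp]: "f \<in> carrier A \<Longrightarrow> f \<otimes> one_series = f"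
    and add_mult: "\<lbrakk>f \<in> carrier A; g \<in> carrier A; h \<in> carrier A\<rbrakk> \<Longrightarrow> (f + g) \<otimes> h = f \<otimes> h + g \<otimes> h"
    and mult_add: "\<lbrakk>f \<in> carrier A; g \<in> carrier A; h \<in> carrier A\<rbrakk> \<Longrightarrow> f \<otimes> (g + h) = f \<otimes> g + f \<otimes> h"
    and scale_mult: "\<lbrakk>f \<in> carrier A; g \<in> carrier A\<rbrakk> \<Longrightarrow> (c \<cdot> f) \<otimes> g = c \<cdot> (f \<otimes> g)"
    and mult_scale: "\<lbrakk>f \<in> carrier A; g \<in> carrier A\<rbrakk> \<Longrightarrow> f \<otimes> (c \<cdot> g) = c \<cdot> (f \<otimes> g)"
    and independent: "\<lbrakk>f \<in> carrier A; v \<notin> S; e v \<noteq> 0\<rbrakk> \<Longrightarrow> f e = 0"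
begin

lemma uminus_closed [simp, intro]: "f \<in> carrier A \<Longrightarrow> - f \<in> carrier A"
  using scale_closed[of f "-1"] by simp

lemma diff_closed [simp, intro]: "\<lbrakk>f \<in> carrier A; g \<in> carrier A\<rbrakk> \<Longrightarrow> f - g \<in> carrier A"
  using add_closed[of f "- g"] by simp

lemma sum_closed [simp, intro]: "(\<And>i. i \<in> I \<Longrightarrow> F i \<in> carrier A) \<Longrightarrow> (\<Sum>i\<in>I. F i) \<in> carrier A"
  by (induction I rule: infinite_finite_induct) auto

lemma zero_mult [simp]: "f \<in> carrier A \<Longrightarrow> 0 \<otimes> f = 0"
  using scale_mult[of 0 f 0] by simp

lemma mult_zero [simp]: "f \<in> carrier A \<Longrightarrow> f \<otimes> 0 = 0"
  using mult_scale[of f 0 0] by simp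

lemma sum_mult:
  assumes "\<And>i. i \<in> I \<Longrightarrow> F i \<in> carrier A" "g \<in> carrier A"
  shows "(\<Sum>i\<in>I. F i) \<otimes> g = (\<Sum>i\<in>I. F i \<otimes> g)"
  using assms(1) by (induction I rule: infinite_finite_induct) (simp_all add: assms(2) add_mult)

lemma mult_sum:
  assumes "\<And>i. i \<in> I \<Longrightarrow> F i \<in> carrier A" "g \<in> carrier A"
  shows "g \<otimes> (\<Sum>i\<in>I. F i) = (\<Sum>i\<in>I. g \<otimes> F i)"
  using assms(1) by (induction I rule: infinite_finite_induct) (simp_all add: assms(2) mult_add)

lemma minus_mult: "\<lbrakk>f \<in> carrier A; g \<in> carrier A\<rbrakk> \<Longrightarrow> (- f) \<otimes> g = - (f \<otimes> g)"
  using scale_mult[of f g "-1"] by simp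

lemma mult_minus: "\<lbrakk>f \<in> carrier A; g \<in> carrier A\<rbrakk> \<Longrightarrow> f \<otimes> (- g) = - (f \<otimes> g)"
  using mult_scale[of f g "-1"] by simp

lemma commutator_eq:
  assumes "f \<in> carrier A" "g \<in> carrier A"
  shows "commutator A f g = f \<otimes> g - g \<otimes> f"
proof -
  have "abelian_group A"
    by (rule abelian_groupI)
      (auto simp: add_eq zero_eq add_series_eq zero_series_eq add_ac intro!: bexI[of _ "- x" for x])
  then have "\<ominus> h = - h" if "h \<in> carrier A" for h
    using that
    by (intro abelian_group.minus_equality) (auto simp: add_eq zero_eq add_series_eq zero_series_eq)
  then show ?thesis
    using assms by (simp add: commutator_def a_minus_def add_eq add_series_eq)
qed

end

locale derivation_on = series_algebra +
  fixes d :: "'a::field_char_0 series \<Rightarrow> 'a series"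
  assumes d_closed [simp, intro]: "f \<in> carrier A \<Longrightarrow> d f \<in> carrier A"
    and d_add: "\<lbrakk>f \<in> carrier A; g \<in> carrier A\<rbrakk> \<Longrightarrow> d (f + g) = d f + d g"
    and d_scale: "f \<in> carrier A \<Longrightarrow> d (c \<cdot> f) = c \<cdot> d f"
    and d_mult: "\<lbrakk>f \<in> carrier A; g \<in> carrier A\<rbrakk> \<Longrightarrow> d (f \<otimes> g) = d f \<otimes> g + f \<otimes> d g"
begin

lemma d_zero [simp]: "d 0 = 0"
  using d_scale[of 0 0] by simp

lemma d_one [simp]: "d one_series = 0"
  using d_mult[of one_series one_series] by simp

lemma d_pow_closed [simp, intro]: "f \<in> carrier A \<Longrightarrow> (d ^^ l) f \<in> carrier A"
  by (induction l) auto

lemma d_pow_zero [simp]: "(d ^^ l) 0 = 0"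
  by (induction l) auto

lemma d_pow_one [simp]: "(d ^^ l) one_series = (if l = 0 then one_series else 0)"
  by (induction l) auto

lemma d_pow_add: "\<lbrakk>f \<in> carrier A; g \<in> carrier A\<rbrakk> \<Longrightarrow> (d ^^ l) (f + g) = (d ^^ l) f + (d ^^ l) g"
  by (induction l) (simp_all add: d_add)

lemma d_pow_scale: "f \<in> carrier A \<Longrightarrow> (d ^^ l) (c \<cdot> f) = c \<cdot> (d ^^ l) f"
  by (induction l) (simp_all add: d_scale)

lemma d_pow_sum:
  "(\<And>i. i \<in> I \<Longrightarrow> F i \<in> carrier A) \<Longrightarrow> (d ^^ l) (\<Sum>i\<in>I. F i) = (\<Sum>i\<in>I. (d ^^ l) (F i))"
  by (induction I rule: infinite_finite_induct) (simp_all add: d_pow_add)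

lemma d_pow_mult:
  assumes f: "f \<in> carrier A" and g: "g \<in> carrier A"
  shows "(d ^^ n) (f \<otimes> g) = (\<Sum>l\<le>n. of_nat (n choose l) \<cdot> ((d ^^ l) f \<otimes> (d ^^ (n - l)) g))"
proof (induction n)
  case (Suc n)
  let ?t = "\<lambda>a b. (d ^^ a) f \<otimes> (d ^^ b) g"
  have "(d ^^ Suc n) (f \<otimes> g) = (d ^^ 1) (\<Sum>l\<le>n. of_nat (n choose l) \<cdot> ?t l (n - l))"
    using Suc by simp
  also have "\<dots> = (\<Sum>l\<le>n. of_nat (n choose l) \<cdot> (?t (Suc l) (n - l) + ?t l (Suc (n - l))))"
    using f g by (subst d_pow_sum) (simp_all add: d_scale d_mult)
  also have "\<dots> = (\<Sum>l\<le>n. of_nat (n choose l) \<cdot> ?t (Suc l) (n - l))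
      + (\<Sum>l\<le>n. of_nat (n choose l) \<cdot> ?t l (Suc n - l))"
    by (simp add: scale_series_add sum.distrib Suc_diff_le)
  also have "(\<Sum>l\<le>n. of_nat (n choose l) \<cdot> ?t l (Suc n - l))
      = (\<Sum>l\<le>Suc n. of_nat (n choose l) \<cdot> ?t l (Suc n - l))"
    by (simp add: binomial_eq_0)
  also have "\<dots> = ?t 0 (Suc n) + (\<Sum>l\<le>n. of_nat (n choose Suc l) \<cdot> ?t (Suc l) (n - l))"
    by (subst sum.atMost_Suc_shift) simp
  also have "(\<Sum>l\<le>n. of_nat (n choose l) \<cdot> ?t (Suc l) (n - l)) +
      (?t 0 (Suc n) + (\<Sum>l\<le>n. of_nat (n choose Suc l) \<cdot> ?t (Suc l) (n - l)))
    = ?t 0 (Suc n) + (\<Sum>l\<le>n. of_nat (Suc n choose Suc l) \<cdot> ?t (Suc l) (n - l))"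
    by (simp add: fun_eq_iff series_apply sum.distrib[symmetric] algebra_simps del: funpow.simps)
  also have "\<dots> = (\<Sum>l\<le>Suc n. of_nat (Suc n choose l) \<cdot> ?t l (Suc n - l))"
    by (subst sum.atMost_Suc_shift) simp
  finally show ?case .
qed simp

end

section \<open>Composition of pseudodifferential symbols\<close>

lemma finite_bounded_pairs: "finite {(p, q). p + q \<le> (s::nat)}"
  by (rule finite_subset[of _ "{..s} \<times> {..s}"]) auto

context derivation_on
begin

text \<open>
  If \<open>a\<^sub>p\<close> and \<open>b\<^sub>q\<close> are the coefficients of \<open>\<partial>\<^bsup>N-p\<^esup>\<close> and \<open>\<partial>\<^bsup>M-q\<^esup>\<close> in two series of orders at most \<open>N\<close>
  and \<open>M\<close>, then this is the coefficient of \<open>\<partial>\<^bsup>N+M-s\<^esup>\<close> in their product. Counting downwards from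
  the leading exponents turns the sums over exponents into sums over finitely many pairs of
  natural numbers.
\<close>

definition twisted_conv ::
  "int \<Rightarrow> (nat \<Rightarrow> 'a series) \<Rightarrow> (nat \<Rightarrow> 'a series) \<Rightarrow> nat \<Rightarrow> 'a series" where
  "twisted_conv N a b s =
    (\<Sum>(p, q)\<in>{(p, q). p + q \<le> s}.
      (of_int (N - int p) gchoose (s - p - q)) \<cdot> (a p \<otimes> (d ^^ (s - p - q)) (b q)))"

lemma twisted_conv_closed:
  "\<lbrakk>\<And>p. a p \<in> carrier A; \<And>q. b q \<in> carrier A\<rbrakk> \<Longrightarrow> twisted_conv N a b s \<in> carrier A"
  unfolding twisted_conv_def by (intro sum_closed) auto

lemma twisted_conv_one_left:
  assumes b: "\<And>q. b q \<in> carrier A"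
  shows "twisted_conv 0 (\<lambda>p. if p = 0 then one_series else 0) b s = b s"
proof -
  have "twisted_conv 0 (\<lambda>p. if p = 0 then one_series else 0) b s =
    (\<Sum>(p, q)\<in>{(0, s)}. (of_int (0 - int p) gchoose (s - p - q)) \<cdot>
      ((if p = 0 then one_series else 0) \<otimes> (d ^^ (s - p - q)) (b q)))"
    unfolding twisted_conv_def
    by (rule sum.mono_neutral_right) (auto simp: finite_bounded_pairs gbinomial_0_left b)
  then show ?thesis by (simp add: b)
qed

lemma twisted_conv_one_right:
  assumes a: "\<And>p. a p \<in> carrier A"
  shows "twisted_conv N a (\<lambda>q. if q = 0 then one_series else 0) s = a s"
proof -
  have "twisted_conv N a (\<lambda>q. if q = 0 then one_series else 0) s =
    (\<Sum>(p, q)\<in>{(s, 0)}. (of_int (N - int p) gchoose (s - p - q)) \<cdot>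
      (a p \<otimes> (d ^^ (s - p - q)) (if q = 0 then one_series else 0)))"
    unfolding twisted_conv_def
    by (rule sum.mono_neutral_right) (auto simp: finite_bounded_pairs a)
  then show ?thesis by (simp add: a)
qed

text \<open>
  The coefficients of \<open>\<partial>\<^bsup>i+j-w\<^esup>\<close> in \<open>(\<partial>\<^sup>i b \<partial>\<^sup>j) c\<close> and in \<open>\<partial>\<^sup>i (b \<partial>\<^sup>j c)\<close>. Expanding
  \<open>d\<^bsup>w-z\<^esup>(b \<otimes> d\<^sup>z(c))\<close> by the Leibniz rule, \<open>d\<^sup>l(b) \<otimes> d\<^bsup>w-l\<^esup>(c)\<close> gets the coefficient
  \<open>\<Sum>\<^sub>z (i choose w-z) (j choose z) (w-z choose l)\<close>. Trinomial revision takes \<open>(i choose l)\<close> out of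
  the sum, and Vandermonde's identity evaluates the rest.
\<close>

lemma monomial_assoc:
  fixes i j :: int
  assumes b: "b \<in> carrier A" and c: "c \<in> carrier A"
  shows "(\<Sum>l\<le>w. ((of_int i gchoose l) * (of_int (i + j - int l) gchoose (w - l))) \<cdot>
            ((d ^^ l) b \<otimes> (d ^^ (w - l)) c)) =
         (\<Sum>z\<le>w. ((of_int i gchoose (w - z)) * (of_int j gchoose z)) \<cdot>
            (d ^^ (w - z)) (b \<otimes> (d ^^ z) c))" (is "_ = ?R")
proof -
  let ?X = "\<lambda>l. (d ^^ l) b \<otimes> (d ^^ (w - l)) c"
  have "?R = (\<Sum>z\<le>w. \<Sum>l\<le>w - z. ((of_int i gchoose (w - z)) * (of_int j gchoose z) *
      (of_nat (w - z) gchoose l)) \<cdot> ?X l)"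
  proof (intro sum.cong refl)
    fix z assume z: "z \<in> {..w}"
    have "(d ^^ (w - z - l)) ((d ^^ z) c) = (d ^^ (w - l)) c" if "l \<le> w - z" for l
      using that z by (simp add: funpow_add[symmetric, THEN fun_cong, unfolded o_apply])
    then show "((of_int i gchoose (w - z)) * (of_int j gchoose z)) \<cdot> (d ^^ (w - z)) (b \<otimes> (d ^^ z) c) =
      (\<Sum>l\<le>w - z. ((of_int i gchoose (w - z)) * (of_int j gchoose z) *
      (of_nat (w - z) gchoose l)) \<cdot> ?X l)"
      using b c by (simp add: d_pow_mult scale_series_sum binomial_gbinomial)
  qed
  also have "\<dots> = (\<Sum>l\<le>w. \<Sum>z\<le>w - l. ((of_int i gchoose (w - z)) * (of_int j gchoose z) *
      (of_nat (w - z) gchoose l)) \<cdot> ?X l)"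
    unfolding sum.Sigma[OF finite_atMost ballI[OF finite_atMost]]
    by (rule sum.reindex_bij_witness[of _ "\<lambda>(x, y). (y, x)" "\<lambda>(x, y). (y, x)"]) auto
  also have "\<dots> = (\<Sum>l\<le>w. ((of_int i gchoose l) * (of_int (i + j - int l) gchoose (w - l))) \<cdot> ?X l)"
  proof (intro sum.cong refl)
    fix l assume l: "l \<in> {..w}"
    have "(\<Sum>z\<le>w - l. (of_int i gchoose (w - z)) * (of_int j gchoose z) * (of_nat (w - z) gchoose l) :: 'a)
        = (\<Sum>z\<le>w - l. (of_int i gchoose l) *
            ((of_int j gchoose z) * (of_int i - of_nat l gchoose (w - l - z))))"
    proof (intro sum.cong refl)
      fix z assume z: "z \<in> {..w - l}"
      have "(of_int i gchoose (w - z)) * (of_nat (w - z) gchoose l) =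
          (of_int i gchoose l) * (of_int i - of_nat l gchoose (w - z - l) :: 'a)"
        by (rule gbinomial_trinomial_revision) (use z l in auto)
      moreover have "w - z - l = w - l - z" by simp
      ultimately show "(of_int i gchoose (w - z)) * (of_int j gchoose z) * (of_nat (w - z) gchoose l) =
        (of_int i gchoose l) *
            ((of_int j gchoose z) * (of_int i - of_nat l gchoose (w - l - z)) :: 'a)"
        by (simp add: mult_ac)
    qed
    also have "\<dots> = (of_int i gchoose l) * (of_int (i + j - int l) gchoose (w - l))"
      using gbinomial_Vandermonde[of "of_int j :: 'a" "of_int i - of_nat l" "w - l"]
      by (simp add: sum_distrib_left[symmetric] atLeast0AtMost algebra_simps)
    finally show "(\<Sum>z\<le>w - l. ((of_int i gchoose (w - z)) * (of_int j gchoose z) *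
      (of_nat (w - z) gchoose l)) \<cdot> ?X l) =
      ((of_int i gchoose l) * (of_int (i + j - int l) gchoose (w - l))) \<cdot> ?X l"
      by (simp add: sum_scale_series)
  qed
  finally show ?thesis by simp
qed

text \<open>
  Both sides are sums over the quadruples \<open>p + q + r + l \<le> s\<close>: the coefficients \<open>a\<^sub>p, b\<^sub>q, c\<^sub>r\<close> and
  the number \<open>l\<close> of derivatives that the inner product spends. For fixed \<open>p, q, r\<close> they agree by
  \<open>monomial_assoc\<close>, with \<open>w\<close> derivatives to be distributed.
\<close>

lemma twisted_conv_assoc:
  assumes a: "\<And>p. a p \<in> carrier A" and b: "\<And>p. b p \<in> carrier A" and c: "\<And>p. c p \<in> carrier A"
  shows "twisted_conv (N + M) (twisted_conv N a b) c s = twisted_conv N a (twisted_conv M b c) s"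
proof -
  define Q where "Q = {(p, q, r). p + q + r \<le> s}"
  define w where "w p q r = s - p - q - r" for p q r
  have fin: "finite Q"
    unfolding Q_def by (rule finite_subset[of _ "{..s} \<times> {..s} \<times> {..s}"]) auto
  note bounded = finite_bounded_pairs[unfolded case_prod_unfold]
  note nested = sum.Sigma[OF bounded ballI[OF bounded]]
  have "twisted_conv (N + M) (twisted_conv N a b) c s =
     (\<Sum>(u, r)\<in>{(p, q). p + q \<le> s}. \<Sum>(p, q)\<in>{(p, q). p + q \<le> u}.
       ((of_int (N - int p) gchoose (u - p - q)) * (of_int (N + M - int u) gchoose (s - u - r))) \<cdot>
       (a p \<otimes> ((d ^^ (u - p - q)) (b q) \<otimes> (d ^^ (s - u - r)) (c r))))"
    unfolding twisted_conv_def[of "N + M"] twisted_conv_def[of N a b]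
    using a b c
    by (intro sum.cong refl) (auto simp: sum_mult scale_series_sum scale_mult mult_assoc
        mult_ac case_prod_unfold intro!: sum.cong)
  also have "\<dots> = (\<Sum>(p, q, r)\<in>Q. \<Sum>l\<le>w p q r.
       ((of_int (N - int p) gchoose l) * (of_int (N - int p + (M - int q) - int l) gchoose (w p q r - l))) \<cdot>
       (a p \<otimes> ((d ^^ l) (b q) \<otimes> (d ^^ (w p q r - l)) (c r))))"
    unfolding case_prod_unfold nested sum.Sigma[OF fin ballI[OF finite_atMost]]
    by (rule sum.reindex_bij_witness[of _ "\<lambda>((p, q, r), l). ((p + q + l, r), (p, q))"
          "\<lambda>((u, r), (p, q)). ((p, q, r), u - p - q)"])
      (auto simp: Q_def w_def algebra_simps of_nat_diff)
  also have "\<dots> = (\<Sum>(p, q, r)\<in>Q. \<Sum>z\<le>w p q r.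
       ((of_int (N - int p) gchoose (w p q r - z)) * (of_int (M - int q) gchoose z)) \<cdot>
       (a p \<otimes> (d ^^ (w p q r - z)) (b q \<otimes> (d ^^ z) (c r))))"
  proof (intro sum.cong refl, clarify)
    fix p q r
    show "(\<Sum>l\<le>w p q r.
       ((of_int (N - int p) gchoose l) * (of_int (N - int p + (M - int q) - int l) gchoose (w p q r - l))) \<cdot>
       (a p \<otimes> ((d ^^ l) (b q) \<otimes> (d ^^ (w p q r - l)) (c r)))) =
      (\<Sum>z\<le>w p q r.
       ((of_int (N - int p) gchoose (w p q r - z)) * (of_int (M - int q) gchoose z)) \<cdot>
       (a p \<otimes> (d ^^ (w p q r - z)) (b q \<otimes> (d ^^ z) (c r))))"
      using arg_cong[OF monomial_assoc[OF b c, where w = "w p q r" and i = "N - int p" and j = "M - int q"],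
        where f = "\<lambda>x. a p \<otimes> x"] a b c
      by (simp add: mult_sum mult_scale)
  qed
  also have "\<dots> = (\<Sum>(p, v)\<in>{(p, q). p + q \<le> s}. \<Sum>(q, r)\<in>{(p, q). p + q \<le> v}.
       ((of_int (N - int p) gchoose (s - p - v)) * (of_int (M - int q) gchoose (v - q - r))) \<cdot>
       (a p \<otimes> (d ^^ (s - p - v)) (b q \<otimes> (d ^^ (v - q - r)) (c r))))"
    unfolding case_prod_unfold nested sum.Sigma[OF fin ballI[OF finite_atMost]]
    by (rule sum.reindex_bij_witness[of _ "\<lambda>((p, v), (q, r)). ((p, q, r), v - q - r)"
          "\<lambda>((p, q, r), z). ((p, q + r + z), (q, r))"])
      (auto simp: Q_def w_def algebra_simps of_nat_diff)
  also have "\<dots> = twisted_conv N a (twisted_conv M b c) s"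
    unfolding twisted_conv_def[of N a] twisted_conv_def[of M b c]
    using a b c
    by (intro sum.cong refl) (auto simp: mult_sum d_pow_sum d_pow_scale scale_series_sum mult_scale
        case_prod_unfold intro!: sum.cong)
  finally show ?thesis .
qed

end

section \<open>The algebra \<open>A((\<partial>\<^sup>-\<^sup>1))\<close>\<close>

lemma coeff_at_zero [simp]: "coeff_at v i 0 = 0"
  and coeff_at_add: "coeff_at v i (f + g) = coeff_at v i f + coeff_at v i g"
  and coeff_at_scale: "coeff_at v i (c \<cdot> f) = c \<cdot> coeff_at v i f"
  for f g :: "'k::field_char_0 series"
  by (auto simp: coeff_at_def fun_eq_iff series_apply)

lemma coeff_at_one: "coeff_at v i one_series = (if i = 0 then one_series else 0)"
proof
  fix e :: "symb \<Rightarrow> int"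
  have 1: "e(v := i) = (\<lambda>_. 0) \<longleftrightarrow> i = 0 \<and> e = (\<lambda>_. 0)" if "e v = 0"
    using that by (auto simp: fun_eq_iff split: if_splits)
  have 2: "e \<noteq> (\<lambda>_. 0)" if "e v \<noteq> 0"
    using that by auto
  show "coeff_at v i one_series e = (if i = 0 then one_series else 0) e"
    by (cases "e v = 0"; cases "i = 0"; use 1 2 in \<open>simp add: coeff_at_def one_series_def series_apply\<close>)
qed

lemma coeff_at_eqD: "coeff_at v i f (e(v := 0)) = f (e(v := i))"
  by (simp add: coeff_at_def)

lemma series_eqI: "(\<And>i. coeff_at v i f = coeff_at v i g) \<Longrightarrow> f = g"
  using coeff_at_eqD[of v "e v" _ e for e] by (metis ext fun_upd_triv)

definition descending_coeffs :: "symb \<Rightarrow> int \<Rightarrow> 'k::zero series \<Rightarrow> nat \<Rightarrow> 'k series" where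
  "descending_coeffs v N f = (\<lambda>p. coeff_at v (N - int p) f)"

lemma descending_coeffs_eqD:
  "descending_coeffs v N f = descending_coeffs v N g \<Longrightarrow> i \<le> N \<Longrightarrow> coeff_at v i f = coeff_at v i g"
  unfolding descending_coeffs_def by (drule fun_cong[of _ _ "nat (N - i)"]) simp

locale pseudodiff_extension = derivation_on A S d
  for A :: "'k::field_char_0 series ring" (structure) and S d +
  fixes v :: symb
  assumes fresh: "v \<notin> S"
begin

abbreviation P :: "'k series ring" where
  "P \<equiv> pseudodiff_ring v d A"

definition order_le :: "int \<Rightarrow> 'k series \<Rightarrow> bool" where
  "order_le N f \<longleftrightarrow> (\<forall>i. coeff_at v i f \<in> carrier A) \<and> (\<forall>i>N. coeff_at v i f = 0)"

lemma carrier_P: "f \<in> carrier P \<longleftrightarrow> (\<exists>N. order_le N f)"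
  by (simp add: pseudodiff_ring_def order_le_def zero_series_eq)

lemma carrier_PI [intro]: "order_le N f \<Longrightarrow> f \<in> carrier P"
  by (auto simp: carrier_P)

lemma order_le_mono: "\<lbrakk>order_le N f; N \<le> N'\<rbrakk> \<Longrightarrow> order_le N' f"
  by (auto simp: order_le_def)

lemma common_order:
  assumes "f \<in> carrier P" "g \<in> carrier P"
  obtains N where "order_le N f" "order_le N g"
proof -
  from assms obtain N M where "order_le N f" "order_le M g"
    by (auto simp: carrier_P)
  then show ?thesis
    by (intro that[of "max N M"]) (auto elim: order_le_mono)
qed

lemma order_le_zero [simp]: "order_le N 0"
  and order_le_add: "\<lbrakk>order_le N f; order_le N g\<rbrakk> \<Longrightarrow> order_le N (f + g)"
  and order_le_scale: "order_le N f \<Longrightarrow> order_le N (c \<cdot> f)"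
  and order_le_one: "order_le 0 one_series"
  by (auto simp: order_le_def coeff_at_add coeff_at_scale coeff_at_one)

lemma order_le_eqI:
  assumes "order_le N f" "order_le N g" "descending_coeffs v N f = descending_coeffs v N g"
  shows "f = g"
proof (rule series_eqI[of v])
  fix i
  show "coeff_at v i f = coeff_at v i g"
    using assms descending_coeffs_eqD[OF assms(3), of i] by (cases "i \<le> N") (auto simp: order_le_def)
qed

lemma finite_exponent_pairs:
  assumes f: "order_le N f" and g: "order_le M g"
  shows "finite {(i, j). coeff_at v i f \<noteq> 0 \<and> coeff_at v j g \<noteq> 0 \<and> m \<le> i + j}"
proof (rule finite_subset)
  show "{(i, j). coeff_at v i f \<noteq> 0 \<and> coeff_at v j g \<noteq> 0 \<and> m \<le> i + j} \<subseteq> {m - M..N} \<times> {m - N..M}"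
    using f g unfolding order_le_def by (force simp: not_less[symmetric])
qed simp

text \<open>
  The defining double sum runs over the exponents that occur in the factors; it may be taken over
  all pairs below the orders \<open>N\<close> and \<open>M\<close>, because the additional terms vanish. At
  exponent vectors that involve \<open>v\<close> the left-hand side is zero by the definition of \<open>coeff_at\<close>,
  and the right-hand side because the elements of \<open>A\<close> are free of \<open>v\<close>.
\<close>

lemma coeff_at_mult:
  assumes f: "order_le N f" and g: "order_le M g"
  shows "coeff_at v m (f \<otimes>\<^bsub>P\<^esub> g) =
    (if m > N + M then 0 else
      twisted_conv N (descending_coeffs v N f) (descending_coeffs v M g) (nat (N + M - m)))"
proof
  fix e
  let ?T = "\<lambda>i j. let l = nat (i + j - m) in
          (of_int i gchoose l) \<cdot> (coeff_at v i f \<otimes> (d ^^ l) (coeff_at v j g))"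
  let ?I = "{(i, j). coeff_at v i f \<noteq> 0 \<and> coeff_at v j g \<noteq> 0 \<and> i + j \<ge> m}"
  let ?J = "{(i, j). i \<le> N \<and> j \<le> M \<and> i + j \<ge> m}"
  have cl: "coeff_at v i f \<in> carrier A" "coeff_at v i g \<in> carrier A" for i
    using f g by (auto simp: order_le_def)
  have "finite ?J"
    by (rule finite_subset[of _ "{m - M..N} \<times> {m - N..M}"]) auto
  moreover have "?I \<subseteq> ?J"
    using f g unfolding order_le_def by (auto simp: not_less[symmetric])
  ultimately have IJ: "(\<Sum>(i, j)\<in>?I. ?T i j) = (\<Sum>(i, j)\<in>?J. ?T i j)"
    by (intro sum.mono_neutral_left) (auto simp: cl Let_def)
  have J: "(\<Sum>(i, j)\<in>?J. ?T i j) = (if m > N + M then 0 else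
      twisted_conv N (descending_coeffs v N f) (descending_coeffs v M g) (nat (N + M - m)))" (is "_ = ?R")
  proof (cases "m > N + M")
    case True
    then have "?J = {}" by auto
    then show ?thesis using True by (simp only: sum.empty if_True)
  next
    case False
    have "(\<Sum>(i, j)\<in>?J. ?T i j) = twisted_conv N (descending_coeffs v N f) (descending_coeffs v M g) (nat (N + M - m))"
      unfolding twisted_conv_def descending_coeffs_def
      by (rule sum.reindex_bij_witness[of _ "\<lambda>(p, q). (N - int p, M - int q)" "\<lambda>(i, j). (nat (N - i), nat (M - j))"])
        (use False in \<open>auto simp: Let_def nat_diff_distrib[symmetric] nat_le_eq_zle
          intro!: arg_cong2[of _ _ _ _ "\<lambda>x y. (_ gchoose x) \<cdot> (_ \<otimes> (d ^^ y) _)"]\<close>)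
    then show ?thesis using False by simp
  qed
  show "coeff_at v m (f \<otimes>\<^bsub>P\<^esub> g) e = ?R e"
  proof (cases "e v = 0")
    case True
    then have "e(v := 0) = e" by auto
    then have "coeff_at v m (f \<otimes>\<^bsub>P\<^esub> g) e = (\<Sum>(i, j)\<in>?I. ?T i j) e"
      using True
      by (simp add: coeff_at_def[of v m] pseudodiff_ring_def series_apply zero_series_eq Let_def case_prod_unfold)
    then show ?thesis by (simp only: IJ J)
  next
    case False
    have "?R \<in> carrier A"
      by (auto intro!: twisted_conv_closed simp: descending_coeffs_def cl)
    then have "?R e = 0"
      using independent fresh False by blast
    then show ?thesis
      using False by (simp add: coeff_at_def[of v m])
  qed
qed

lemma order_le_mult:
  assumes "order_le N f" "order_le M g"
  shows "order_le (N + M) (f \<otimes>\<^bsub>P\<^esub> g)"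
  using assms
  by (auto simp: order_le_def[of "N + M"] coeff_at_mult[OF assms] intro!: twisted_conv_closed)
    (auto simp: order_le_def descending_coeffs_def)

lemma descending_coeffs_mult:
  assumes "order_le N f" "order_le M g"
  shows "descending_coeffs v (N + M) (f \<otimes>\<^bsub>P\<^esub> g) =
    twisted_conv N (descending_coeffs v N f) (descending_coeffs v M g)"
  by (auto simp: descending_coeffs_def[of v "N + M"] coeff_at_mult[OF assms])

lemma descending_coeffs_closed [simp, intro]: "order_le N f \<Longrightarrow> descending_coeffs v N f p \<in> carrier A"
  by (auto simp: order_le_def descending_coeffs_def)

lemma descending_coeffs_add:
    "descending_coeffs v N (f + g) = (\<lambda>p. descending_coeffs v N f p + descending_coeffs v N g p)"
  and descending_coeffs_scale: "descending_coeffs v N (c \<cdot> f) = (\<lambda>p. c \<cdot> descending_coeffs v N f p)"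
  and descending_coeffs_one: "descending_coeffs v 0 one_series = (\<lambda>p. if p = 0 then one_series else 0)"
  for f g :: "'k series"
  by (auto simp: descending_coeffs_def coeff_at_add coeff_at_scale coeff_at_one)

text \<open>
  A series of order at most \<open>N\<close> is determined by its descending coefficients, on which the
  product is \<open>twisted_conv\<close>; every axiom becomes the corresponding identity for \<open>twisted_conv\<close>.
\<close>

lemma pseudodiff_series_algebra: "series_algebra P (insert v S)"
proof
  show "add P = add_series" "\<zero>\<^bsub>P\<^esub> = zero_series" "\<one>\<^bsub>P\<^esub> = one_series"
    by (simp_all add: pseudodiff_ring_def)
  show "0 \<in> carrier P" "one_series \<in> carrier P"
    using order_le_zero order_le_one by blast+
next
  fix f g :: "'k series" assume fg: "f \<in> carrier P" "g \<in> carrier P"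
  then obtain N where N: "order_le N f" "order_le N g"
    by (rule common_order)
  obtain M where M: "order_le M g" using fg by (auto simp: carrier_P)
  show "f + g \<in> carrier P" "f \<otimes>\<^bsub>P\<^esub> g \<in> carrier P"
    using order_le_add[OF N] order_le_mult[OF N] by blast+
  note comp = order_le_mult order_le_scale descending_coeffs_mult descending_coeffs_scale N(1) M
  show "(c \<cdot> f) \<otimes>\<^bsub>P\<^esub> g = c \<cdot> (f \<otimes>\<^bsub>P\<^esub> g)" for c
    by (rule order_le_eqI[of "N + M"])
      (auto simp: comp fun_eq_iff[of "descending_coeffs _ _ _"] twisted_conv_def
        scale_mult scale_series_sum mult_ac case_prod_unfold
        intro!: sum.cong)
  show "f \<otimes>\<^bsub>P\<^esub> (c \<cdot> g) = c \<cdot> (f \<otimes>\<^bsub>P\<^esub> g)" for c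
    by (rule order_le_eqI[of "N + M"])
      (auto simp: comp fun_eq_iff[of "descending_coeffs _ _ _"] twisted_conv_def
        d_pow_scale mult_scale scale_series_sum mult_ac case_prod_unfold
        intro!: sum.cong)
next
  fix f c assume "f \<in> carrier P"
  then show "c \<cdot> f \<in> carrier P"
    using order_le_scale unfolding carrier_P by blast
next
  fix f assume "f \<in> carrier P"
  then obtain N where N: "order_le N f" by (auto simp: carrier_P)
  show "one_series \<otimes>\<^bsub>P\<^esub> f = f"
  proof (rule order_le_eqI[of N])
    show "order_le N (one_series \<otimes>\<^bsub>P\<^esub> f)"
      using order_le_mult[OF order_le_one N] by simp
    show "descending_coeffs v N (one_series \<otimes>\<^bsub>P\<^esub> f) = descending_coeffs v N f"
      using descending_coeffs_mult[OF order_le_one N] N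
      by (simp add: descending_coeffs_one twisted_conv_one_left fun_eq_iff[of "descending_coeffs _ _ _"])
  qed fact
  show "f \<otimes>\<^bsub>P\<^esub> one_series = f"
  proof (rule order_le_eqI[of N])
    show "order_le N (f \<otimes>\<^bsub>P\<^esub> one_series)"
      using order_le_mult[OF N order_le_one] by simp
    show "descending_coeffs v N (f \<otimes>\<^bsub>P\<^esub> one_series) = descending_coeffs v N f"
      using descending_coeffs_mult[OF N order_le_one] N
      by (simp add: descending_coeffs_one twisted_conv_one_right fun_eq_iff[of "descending_coeffs _ _ _"])
  qed fact
next
  fix f g h assume "f \<in> carrier P" "g \<in> carrier P" "h \<in> carrier P"
  then obtain N M K where N: "order_le N f" "order_le M g" "order_le K h"
    unfolding carrier_P by blast
  show "f \<otimes>\<^bsub>P\<^esub> g \<otimes>\<^bsub>P\<^esub> h = f \<otimes>\<^bsub>P\<^esub> (g \<otimes>\<^bsub>P\<^esub> h)"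
  proof (rule order_le_eqI[of "N + M + K"])
    show "order_le (N + M + K) (f \<otimes>\<^bsub>P\<^esub> g \<otimes>\<^bsub>P\<^esub> h)"
      by (intro order_le_mult N)
    show "order_le (N + M + K) (f \<otimes>\<^bsub>P\<^esub> (g \<otimes>\<^bsub>P\<^esub> h))"
      using order_le_mult[OF N(1) order_le_mult[OF N(2,3)]] by (simp add: add.assoc)
    show "descending_coeffs v (N + M + K) (f \<otimes>\<^bsub>P\<^esub> g \<otimes>\<^bsub>P\<^esub> h) =
        descending_coeffs v (N + M + K) (f \<otimes>\<^bsub>P\<^esub> (g \<otimes>\<^bsub>P\<^esub> h))"
      using descending_coeffs_mult[OF order_le_mult[OF N(1,2)] N(3)]
        descending_coeffs_mult[OF N(1) order_le_mult[OF N(2,3)]] N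
      by (simp add: descending_coeffs_mult twisted_conv_assoc add.assoc ext)
  qed
next
  fix f g h assume f: "f \<in> carrier P" and g: "g \<in> carrier P" and h: "h \<in> carrier P"
  from f g obtain N where N: "order_le N f" "order_le N g" by (rule common_order)
  from h obtain M where M: "order_le M h" by (auto simp: carrier_P)
  note comp = order_le_mult order_le_add descending_coeffs_mult descending_coeffs_add N M
  show "(f + g) \<otimes>\<^bsub>P\<^esub> h = f \<otimes>\<^bsub>P\<^esub> h + g \<otimes>\<^bsub>P\<^esub> h"
    by (rule order_le_eqI[of "N + M"])
      (auto simp: comp fun_eq_iff[of "descending_coeffs _ _ _"] twisted_conv_def
        add_mult scale_series_add sum.distrib case_prod_unfold)
next
  fix f g h assume f: "f \<in> carrier P" and g: "g \<in> carrier P" and h: "h \<in> carrier P"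
  from g h obtain N where N: "order_le N g" "order_le N h" by (rule common_order)
  from f obtain M where M: "order_le M f" by (auto simp: carrier_P)
  note comp = order_le_mult order_le_add descending_coeffs_mult descending_coeffs_add N M
  show "f \<otimes>\<^bsub>P\<^esub> (g + h) = f \<otimes>\<^bsub>P\<^esub> g + f \<otimes>\<^bsub>P\<^esub> h"
    by (rule order_le_eqI[of "M + N"])
      (auto simp: comp fun_eq_iff[of "descending_coeffs _ _ _"] twisted_conv_def
        mult_add d_pow_add scale_series_add sum.distrib case_prod_unfold)
next
  fix f w and e :: "symb \<Rightarrow> int" assume f: "f \<in> carrier P" and w: "w \<notin> insert v S" "e w \<noteq> 0"
  have "coeff_at v (e v) f (e(v := 0)) = 0"
    by (rule independent[of _ w]) (use f w in \<open>auto simp: carrier_P order_le_def\<close>)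
  then show "f e = 0"
    by (simp add: coeff_at_def)
qed

end

section \<open>Derivations and traces on \<open>A((\<partial>\<^sup>-\<^sup>1))\<close>\<close>

lemma partial_x_add: "partial_x j (f + g) = partial_x j f + partial_x j g"
  and partial_x_scale: "partial_x j (c \<cdot> f) = c \<cdot> partial_x j f"
  for f g :: "'k::field_char_0 series"
  by (auto simp: partial_x_def fun_eq_iff series_apply algebra_simps)

lemma partial_x_zero [simp]: "partial_x j 0 = (0 :: 'k::field_char_0 series)"
  by (simp add: partial_x_def fun_eq_iff series_apply)

lemma partial_x_commute: "partial_x i (partial_x j f) = partial_x j (partial_x i f)"
  by (cases "i = j") (auto simp: partial_x_def fun_eq_iff fun_upd_twist mult_ac)

lemma coeff_at_partial_x:
  "v \<noteq> Xvar j \<Longrightarrow> coeff_at v i (partial_x j f) = partial_x j (coeff_at v i f)"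
  by (auto simp: partial_x_def coeff_at_def fun_eq_iff fun_upd_twist)

lemma coeff_at_partial_x_same:
  "coeff_at (Xvar j) i (partial_x j f) = of_int (i + 1) \<cdot> coeff_at (Xvar j) (i + 1) f"
  by (auto simp: partial_x_def coeff_at_def fun_eq_iff series_apply)

context pseudodiff_extension
begin

text \<open>
  Since \<open>\<delta>\<close> commutes with \<open>d\<close>, it takes a term \<open>(i choose l) a d\<^sup>l(b)\<close> of the product to
  \<open>(i choose l) (\<delta>(a) d\<^sup>l(b) + a d\<^sup>l(\<delta>(b)))\<close>, the sum of the corresponding terms of the products
  \<open>\<delta>(f) g\<close> and \<open>f \<delta>(g)\<close>. This is how the \<open>\<partial>/\<partial>x\<^sub>j\<close> climb the tower.
\<close>

lemma coefficientwise_derivation: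
  assumes \<delta>: "derivation_on A S \<delta>"
    and coeff: "\<And>i f. coeff_at v i (\<delta> f) = \<delta> (coeff_at v i f)"
    and comm: "\<And>f. f \<in> carrier A \<Longrightarrow> \<delta> (d f) = d (\<delta> f)"
  shows "derivation_on P (insert v S) \<delta>"
proof -
  interpret \<delta>: derivation_on A S \<delta> by fact
  interpret P: series_algebra P "insert v S" by (rule pseudodiff_series_algebra)
  have pow: "\<delta> ((d ^^ l) f) = (d ^^ l) (\<delta> f)" if "f \<in> carrier A" for f l
    using that by (induction l) (simp_all add: comm)
  have ord: "order_le N (\<delta> f)" if "order_le N f" for N f
    using that by (auto simp: order_le_def coeff)
  have desc: "descending_coeffs v N (\<delta> f) = (\<lambda>p. \<delta> (descending_coeffs v N f p))" for N f
    by (simp add: descending_coeffs_def coeff)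
  show ?thesis
  proof
    fix f assume "f \<in> carrier P"
    then obtain N where N: "order_le N f" by (auto simp: carrier_P)
    show "\<delta> f \<in> carrier P" using ord[OF N] ..
    show "\<delta> (c \<cdot> f) = c \<cdot> \<delta> f" for c
      by (rule series_eqI[of v]) (use N in \<open>simp add: coeff coeff_at_scale order_le_def \<delta>.d_scale\<close>)
  next
    fix f g assume "f \<in> carrier P" "g \<in> carrier P"
    then obtain N where N: "order_le N f" "order_le N g" by (rule common_order)
    show "\<delta> (f + g) = \<delta> f + \<delta> g"
      by (rule series_eqI[of v]) (use N in \<open>simp add: coeff coeff_at_add order_le_def \<delta>.d_add\<close>)
    have conv: "\<delta> (twisted_conv N a b s) = twisted_conv N (\<lambda>p. \<delta> (a p)) b s + twisted_conv N a (\<lambda>q. \<delta> (b q)) s"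
      if ab: "\<And>p. a p \<in> carrier A" "\<And>p. b p \<in> carrier A" for a b s
    proof -
      have "\<delta> (twisted_conv N a b s) = (\<Sum>(p, q)\<in>{(p, q). p + q \<le> s}.
          \<delta> ((of_int (N - int p) gchoose (s - p - q)) \<cdot> (a p \<otimes> (d ^^ (s - p - q)) (b q))))"
        unfolding twisted_conv_def
        using \<delta>.d_pow_sum[of "{(p, q). p + q \<le> s}" _ 1] ab by (simp add: case_prod_unfold)
      then show ?thesis
        using ab by (simp add: twisted_conv_def \<delta>.d_scale \<delta>.d_mult pow scale_series_add
            sum.distrib case_prod_unfold)
    qed
    obtain M where M: "order_le M g"
      using N by blast
    note ords = N(1) M ord[OF N(1)] ord[OF M]
    show "\<delta> (f \<otimes>\<^bsub>P\<^esub> g) = \<delta> f \<otimes>\<^bsub>P\<^esub> g + f \<otimes>\<^bsub>P\<^esub> \<delta> g"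
    proof (rule order_le_eqI[of "N + M"])
      show "descending_coeffs v (N + M) (\<delta> (f \<otimes>\<^bsub>P\<^esub> g)) =
        descending_coeffs v (N + M) (\<delta> f \<otimes>\<^bsub>P\<^esub> g + f \<otimes>\<^bsub>P\<^esub> \<delta> g)"
        using ords by (simp add: desc[of "N + M"] descending_coeffs_mult conv descending_coeffs_add desc[of N, symmetric]
          desc[of M, symmetric])
    qed (intro ord order_le_mult order_le_add ords)+
  qed
qed

text \<open>
  The inductive step for the residue: \<open>\<tau>\<close> after the coefficient of \<open>\<partial>\<^sup>-\<^sup>1\<close> is again a trace. The
  terms of the two products are equal one by one, after integration by parts (\<open>parts\<close>) and
  negation of the upper index of the binomial coefficient.
\<close>

lemma trace_extension:
  fixes \<tau> :: "'k series \<Rightarrow> 'k"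
  assumes add: "\<And>f g. \<tau> (f + g) = \<tau> f + \<tau> g" and scale: "\<And>c f. \<tau> (c \<cdot> f) = c * \<tau> f"
    and trace: "\<And>f g. \<lbrakk>f \<in> carrier A; g \<in> carrier A\<rbrakk> \<Longrightarrow> \<tau> (f \<otimes> g) = \<tau> (g \<otimes> f)"
    and exact: "\<And>f. f \<in> carrier A \<Longrightarrow> \<tau> (d f) = 0"
    and fg: "f \<in> carrier P" "g \<in> carrier P"
  shows "\<tau> (coeff_at v (-1) (f \<otimes>\<^bsub>P\<^esub> g)) = \<tau> (coeff_at v (-1) (g \<otimes>\<^bsub>P\<^esub> f))"
proof -
  have \<tau>_0: "\<tau> 0 = 0"
    using scale[of 0 0] by simp
  have \<tau>_sum: "\<tau> (sum F I) = (\<Sum>i\<in>I. \<tau> (F i))" for F :: "nat \<times> nat \<Rightarrow> 'k series" and I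
    by (induction I rule: infinite_finite_induct) (simp_all add: \<tau>_0 add)
  have parts: "\<tau> (a \<otimes> (d ^^ l) b) = (-1) ^ l * \<tau> ((d ^^ l) a \<otimes> b)"
    if "a \<in> carrier A" "b \<in> carrier A" for a b l
    using that
  proof (induction l arbitrary: a)
    case (Suc l)
    have "\<tau> (d a \<otimes> (d ^^ l) b) + \<tau> (a \<otimes> d ((d ^^ l) b)) = 0"
      using exact[of "a \<otimes> (d ^^ l) b"] Suc.prems by (simp add: d_mult add)
    moreover have "\<tau> (d a \<otimes> (d ^^ l) b) = (-1) ^ l * \<tau> ((d ^^ l) (d a) \<otimes> b)"
      using Suc by simp
    ultimately show ?case
      by (simp add: add_eq_0_iff funpow_swap1)
  qed simp
  obtain N where "order_le N f" "order_le N g"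
    using fg by (rule common_order)
  then have N: "order_le \<bar>N\<bar> f" "order_le \<bar>N\<bar> g"
    by (auto elim: order_le_mono)
  \<comment> \<open>As \<open>M \<ge> 0\<close>, the exponent \<open>-1\<close> has the form \<open>M + M - s\<close> with a natural number \<open>s\<close>.\<close>
  define M where "M = \<bar>N\<bar>"
  define s where "s = nat (2 * M + 1)"
  let ?a = "descending_coeffs v M f" and ?b = "descending_coeffs v M g"
  have cl: "?a p \<in> carrier A" "?b p \<in> carrier A" for p
    using N by (auto simp: M_def)
  have coeff: "coeff_at v (-1) (f \<otimes>\<^bsub>P\<^esub> g) = twisted_conv M ?a ?b s"
    "coeff_at v (-1) (g \<otimes>\<^bsub>P\<^esub> f) = twisted_conv M ?b ?a s"
    using N by (simp_all add: coeff_at_mult M_def s_def)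
  have term_eq: "(of_int (M - int p) gchoose l) * \<tau> (?a p \<otimes> (d ^^ l) (?b q)) =
      (of_int (M - int q) gchoose l) * \<tau> (?b q \<otimes> (d ^^ l) (?a p))"
    if "p + q \<le> s" "l = s - p - q" for p q l
  proof -
    have "of_nat l - of_int (M - int p) - 1 = (of_int (M - int q) :: 'k)"
      using that by (simp add: s_def M_def of_nat_diff)
    then have "(of_int (M - int p) gchoose l) = (-1) ^ l * (of_int (M - int q) gchoose l :: 'k)"
      using gbinomial_negated_upper[of "of_int (M - int p) :: 'k" l] by (simp only:)
    then show ?thesis
      using cl by (simp add: parts[of "?a p"] trace[of "(d ^^ l) (?a p)"] mult_ac flip: power_mult_distrib)
  qed
  have "\<tau> (twisted_conv M ?a ?b s) = (\<Sum>(p, q)\<in>{(p, q). p + q \<le> s}.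
      (of_int (M - int p) gchoose (s - p - q)) * \<tau> (?a p \<otimes> (d ^^ (s - p - q)) (?b q)))"
    by (simp add: twisted_conv_def \<tau>_sum scale case_prod_unfold)
  also have "\<dots> = (\<Sum>(p, q)\<in>{(p, q). p + q \<le> s}.
      (of_int (M - int q) gchoose (s - p - q)) * \<tau> (?b q \<otimes> (d ^^ (s - p - q)) (?a p)))"
    by (rule sum.cong, rule refl, clarify, rule term_eq, simp_all)
  also have "\<dots> = (\<Sum>(p, q)\<in>{(p, q). p + q \<le> s}.
      (of_int (M - int p) gchoose (s - p - q)) * \<tau> (?b p \<otimes> (d ^^ (s - p - q)) (?a q)))"
    by (rule sum.reindex_bij_witness[of _ "\<lambda>(p, q). (q, p)" "\<lambda>(p, q). (q, p)"])
      (auto simp: add.commute)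
  also have "\<dots> = \<tau> (twisted_conv M ?b ?a s)"
    by (simp add: twisted_conv_def \<tau>_sum scale case_prod_unfold)
  finally show ?thesis
    by (simp add: coeff)
qed

end

section \<open>Laurent series\<close>

text \<open>
  The substitution \<open>v \<mapsto> v\<^sup>-\<^sup>1\<close>. It identifies \<open>A((v))\<close> with \<open>A((\<partial>\<^sup>-\<^sup>1))\<close> for the zero derivation, in
  which \<open>\<partial>\<close> is a central variable and the exponents are bounded above instead of below.
\<close>

definition reflect :: "symb \<Rightarrow> 'k series \<Rightarrow> 'k series" where
  "reflect v f = (\<lambda>e. f (e(v := - e v)))"

lemma reflect_reflect [simp]: "reflect v (reflect v f) = f"
  by (simp add: reflect_def)

lemma reflect_eq_iff: "reflect v f = reflect v g \<longleftrightarrow> f = g"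
  by (auto dest: arg_cong[of _ _ "reflect v"])

lemma coeff_at_reflect: "coeff_at v i (reflect v f) = coeff_at v (- i) f"
  by (auto simp: reflect_def coeff_at_def)

lemma reflect_add: "reflect v (f + g) = reflect v f + reflect v g"
  and reflect_scale: "reflect v (c \<cdot> f) = c \<cdot> reflect v f"
  and reflect_zero: "reflect v 0 = (0 :: 'k series)"
  for f g :: "'k::field_char_0 series"
  by (auto simp: reflect_def fun_eq_iff series_apply)

lemma reflect_one: "reflect v one_series = one_series"
  by (rule series_eqI[of v]) (simp add: coeff_at_reflect coeff_at_one)

lemma reflect_partial_x: "v \<noteq> Xvar j \<Longrightarrow> reflect v (partial_x j f) = partial_x j (reflect v f)"
  by (simp add: reflect_def partial_x_def fun_eq_iff fun_upd_twist[of v "Xvar j"])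

text \<open>
  Named, so that the facts of \<open>derivation_on\<close> keep speaking of a function: instantiated with
  \<open>\<lambda>_. 0\<close> they would \<open>\<beta>\<close>-reduce to statements about the series \<open>0\<close>.
\<close>

definition null_derivation :: "'k::field_char_0 series \<Rightarrow> 'k series" where
  "null_derivation f = 0"

lemma null_derivation_pow: "(null_derivation ^^ l) f = (if l = 0 then f else 0)"
  by (cases l) (simp_all add: null_derivation_def)

locale laurent_extension = series_algebra A S
  for A :: "'k::field_char_0 series ring" (structure) and S +
  fixes v :: symb
  assumes fresh: "v \<notin> S"
begin

abbreviation Q :: "'k series ring" where
  "Q \<equiv> laurent_ring v A"

sublocale pd: pseudodiff_extension A S null_derivation v
  by unfold_locales (simp_all add: fresh null_derivation_def)

lemma carrier_reflect: "f \<in> carrier Q \<longleftrightarrow> reflect v f \<in> carrier pd.P"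
proof -
  have "(\<exists>N. \<forall>i<N. coeff_at v i f = 0) \<longleftrightarrow> (\<exists>N. \<forall>i>N. coeff_at v (- i) f = 0)"
  proof safe
    fix N assume "\<forall>i<N. coeff_at v i f = 0"
    then show "\<exists>N. \<forall>i>N. coeff_at v (- i) f = 0"
      by (intro exI[of _ "- N"]) auto
  next
    fix N assume *: "\<forall>i>N. coeff_at v (- i) f = 0"
    have "coeff_at v i f = 0" if "i < - N" for i
      using *[rule_format, of "- i"] that by simp
    then show "\<exists>N. \<forall>i<N. coeff_at v i f = 0"
      by blast
  qed
  moreover have "(\<forall>i. coeff_at v i f \<in> carrier A) \<longleftrightarrow> (\<forall>i. coeff_at v (- i) f \<in> carrier A)"
    by (metis minus_minus)
  ultimately show ?thesis
    by (simp add: laurent_ring_def pseudodiff_ring_def coeff_at_reflect zero_series_eq)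
qed

text \<open>
  With the zero derivation only the terms with \<open>l = 0\<close>, that is \<open>i + j = e v\<close>, survive in the
  product of \<open>A((\<partial>\<^sup>-\<^sup>1))\<close>; their binomial coefficient is \<open>1\<close>.
\<close>

lemma mult_reflect:
  assumes f: "f \<in> carrier Q" and g: "g \<in> carrier Q"
  shows "reflect v (f \<otimes>\<^bsub>Q\<^esub> g) = reflect v f \<otimes>\<^bsub>pd.P\<^esub> reflect v g"
proof
  fix e
  let ?f = "reflect v f" and ?g = "reflect v g"
  let ?I = "{(i, j). coeff_at v i ?f \<noteq> 0 \<and> coeff_at v j ?g \<noteq> 0 \<and> e v \<le> i + j}"
  let ?J = "{(i, j). coeff_at v i ?f \<noteq> 0 \<and> coeff_at v j ?g \<noteq> 0 \<and> i + j = e v}"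
  let ?T = "\<lambda>i j. let l = nat (i + j - e v) in
          (of_int i gchoose l) * (coeff_at v i ?f \<otimes> (null_derivation ^^ l) (coeff_at v j ?g)) (e(v := 0))"
  have fg: "?f \<in> carrier pd.P" "?g \<in> carrier pd.P"
    using f g by (simp_all add: carrier_reflect)
  then obtain N where N: "pd.order_le N ?f" "pd.order_le N ?g"
    by (rule pd.common_order)
  have "(?f \<otimes>\<^bsub>pd.P\<^esub> ?g) e = (\<Sum>(i, j)\<in>?I. ?T i j)"
    by (simp add: pseudodiff_ring_def zero_series_eq)
  also have "\<dots> = (\<Sum>(i, j)\<in>?J. ?T i j)"
    using N by (intro sum.mono_neutral_right pd.finite_exponent_pairs[OF N])
      (auto simp: null_derivation_pow series_apply pd.order_le_def)
  also have "\<dots> = (\<Sum>(i, j)\<in>{(i, j). coeff_at v i f \<noteq> 0 \<and> coeff_at v j g \<noteq> 0 \<and> i + j = - e v}.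
      (coeff_at v i f \<otimes> coeff_at v j g) (e(v := 0)))"
    by (rule sum.reindex_bij_witness[of _ "\<lambda>(i, j). (- i, - j)" "\<lambda>(i, j). (- i, - j)"])
      (auto simp: coeff_at_reflect)
  also have "\<dots> = reflect v (f \<otimes>\<^bsub>Q\<^esub> g) e"
    by (simp add: reflect_def laurent_ring_def zero_series_eq)
  finally show "reflect v (f \<otimes>\<^bsub>Q\<^esub> g) e = (?f \<otimes>\<^bsub>pd.P\<^esub> ?g) e" ..
qed

lemma laurent_series_algebra: "series_algebra Q (insert v S)"
proof -
  interpret P: series_algebra pd.P "insert v S" by (rule pd.pseudodiff_series_algebra)
  have closed: "f \<otimes>\<^bsub>Q\<^esub> g \<in> carrier Q" if "f \<in> carrier Q" "g \<in> carrier Q" for f g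
    using that by (simp add: carrier_reflect[of "f \<otimes>\<^bsub>Q\<^esub> g"] mult_reflect) (simp add: carrier_reflect)
  note reflect_simps = reflect_add reflect_scale reflect_one reflect_zero
  have add_closed: "f + g \<in> carrier Q" if "f \<in> carrier Q" "g \<in> carrier Q" for f g
    using that by (simp add: carrier_reflect reflect_simps)
  have scale_closed: "c \<cdot> f \<in> carrier Q" if "f \<in> carrier Q" for f c
    using that by (simp add: carrier_reflect reflect_simps)
  have one_closed: "one_series \<in> carrier Q"
    by (simp add: carrier_reflect reflect_simps)
  have refl: "reflect v f \<in> carrier pd.P" if "f \<in> carrier Q" for f
    using that by (simp add: carrier_reflect)
  note simps = refl reflect_simps mult_reflect closed add_closed scale_closed one_closed
  show ?thesis
  proof
    show "0 \<in> carrier Q" by (simp add: carrier_reflect reflect_simps)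
    show "add Q = add_series" "\<zero>\<^bsub>Q\<^esub> = zero_series" "\<one>\<^bsub>Q\<^esub> = one_series"
      by (simp_all add: laurent_ring_def)
  next
    fix f g h assume "f \<in> carrier Q" "g \<in> carrier Q" "h \<in> carrier Q"
    then show "f \<otimes>\<^bsub>Q\<^esub> g \<otimes>\<^bsub>Q\<^esub> h = f \<otimes>\<^bsub>Q\<^esub> (g \<otimes>\<^bsub>Q\<^esub> h)"
      "(f + g) \<otimes>\<^bsub>Q\<^esub> h = f \<otimes>\<^bsub>Q\<^esub> h + g \<otimes>\<^bsub>Q\<^esub> h"
      "f \<otimes>\<^bsub>Q\<^esub> (g + h) = f \<otimes>\<^bsub>Q\<^esub> g + f \<otimes>\<^bsub>Q\<^esub> h"
      by (subst reflect_eq_iff[of v, symmetric]; simp add: simps P.mult_assoc P.add_mult P.mult_add)+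
  next
    fix f g c assume "f \<in> carrier Q" "g \<in> carrier Q"
    then show "(c \<cdot> f) \<otimes>\<^bsub>Q\<^esub> g = c \<cdot> (f \<otimes>\<^bsub>Q\<^esub> g)" "f \<otimes>\<^bsub>Q\<^esub> (c \<cdot> g) = c \<cdot> (f \<otimes>\<^bsub>Q\<^esub> g)"
      by (subst reflect_eq_iff[of v, symmetric]; simp add: simps P.mult_scale P.scale_mult)+
  next
    fix f assume "f \<in> carrier Q"
    then show "one_series \<otimes>\<^bsub>Q\<^esub> f = f" "f \<otimes>\<^bsub>Q\<^esub> one_series = f"
      by (subst reflect_eq_iff[of v, symmetric]; simp add: simps)+
  next
    fix f w and e :: "symb \<Rightarrow> int" assume f: "f \<in> carrier Q" and w: "w \<notin> insert v S" "e w \<noteq> 0"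
    have "reflect v f (e(v := - e v)) = 0"
      by (rule P.independent[of _ w]) (use f w in \<open>auto simp: refl\<close>)
    then show "f e = 0"
      by (simp add: reflect_def)
  qed (fact closed add_closed scale_closed one_closed)+
qed

text \<open>
  \<open>\<partial>/\<partial>x\<^sub>j\<close> for another variable than \<open>v\<close> acts on the coefficients and commutes with the reflection.
\<close>

lemma partial_x_laurent_other:
  assumes "derivation_on A S (partial_x j)" "v \<noteq> Xvar j"
  shows "derivation_on Q (insert v S) (partial_x j)"
proof -
  interpret P: derivation_on pd.P "insert v S" "partial_x j"
    using assms by (intro pd.coefficientwise_derivation) (simp_all add: coeff_at_partial_x null_derivation_def)
  interpret Q: series_algebra Q "insert v S" by (rule laurent_series_algebra)
  have closed: "partial_x j f \<in> carrier Q" if "f \<in> carrier Q" for f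
    using that assms(2) by (simp add: carrier_reflect reflect_partial_x)
  show ?thesis
  proof
    fix f g assume fg: "f \<in> carrier Q" "g \<in> carrier Q"
    then have "reflect v f \<in> carrier pd.P" "reflect v g \<in> carrier pd.P"
      by (simp_all add: carrier_reflect)
    with fg show "partial_x j (f \<otimes>\<^bsub>Q\<^esub> g) = partial_x j f \<otimes>\<^bsub>Q\<^esub> g + f \<otimes>\<^bsub>Q\<^esub> partial_x j g"
      by (subst reflect_eq_iff[of v, symmetric])
        (simp add: reflect_partial_x assms(2) mult_reflect reflect_add closed P.d_mult)
  qed (simp_all add: closed partial_x_add partial_x_scale)
qed

lemma laurent_coeff_mult:
  assumes f: "f \<in> carrier Q" "\<forall>i<N. coeff_at v i f = 0"
    and g: "g \<in> carrier Q" "\<forall>j<M. coeff_at v j g = 0"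
  shows "coeff_at v m (f \<otimes>\<^bsub>Q\<^esub> g) = (\<Sum>i=N..m - M. coeff_at v i f \<otimes> coeff_at v (m - i) g)"
proof
  fix e
  have cl: "coeff_at v i f \<in> carrier A" "coeff_at v i g \<in> carrier A" for i
    using f(1) g(1) by (simp_all add: laurent_ring_def)
  let ?J = "{(i, j). coeff_at v i f \<noteq> 0 \<and> coeff_at v j g \<noteq> 0 \<and> i + j = m}"
  let ?K = "{i \<in> {N..m - M}. coeff_at v i f \<noteq> 0 \<and> coeff_at v (m - i) g \<noteq> 0}"
  have K: "(\<Sum>(i, j)\<in>?J. coeff_at v i f \<otimes> coeff_at v j g) =
      (\<Sum>i\<in>?K. coeff_at v i f \<otimes> coeff_at v (m - i) g)"
    by (rule sum.reindex_bij_witness[of _ "\<lambda>i. (i, m - i)" fst])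
      (use f(2) g(2) in \<open>force simp: not_less[symmetric]\<close>)+
  also have "\<dots> = (\<Sum>i=N..m - M. coeff_at v i f \<otimes> coeff_at v (m - i) g)"
    by (intro sum.mono_neutral_left) (auto simp: cl)
  finally have J: "(\<Sum>(i, j)\<in>?J. coeff_at v i f \<otimes> coeff_at v j g) =
      (\<Sum>i=N..m - M. coeff_at v i f \<otimes> coeff_at v (m - i) g)" (is "_ = ?R") .
  show "coeff_at v m (f \<otimes>\<^bsub>Q\<^esub> g) e = ?R e"
  proof (cases "e v = 0")
    case True
    then have "e(v := 0) = e" by auto
    then have "coeff_at v m (f \<otimes>\<^bsub>Q\<^esub> g) e = (\<Sum>(i, j)\<in>?J. coeff_at v i f \<otimes> coeff_at v j g) e"
      using True
      by (simp add: coeff_at_def[of v m] laurent_ring_def series_apply zero_series_eq case_prod_unfold)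
    then show ?thesis by (simp only: J)
  next
    case False
    have "?R e = 0"
      by (rule independent[of _ v]) (auto simp: cl fresh False)
    then show ?thesis
      using False by (simp add: coeff_at_def[of v m])
  qed
qed

lemma lower_bound:
  assumes "f \<in> carrier Q"
  obtains N where "\<forall>i<N. coeff_at v i f = 0"
  using assms by (auto simp: laurent_ring_def zero_series_eq)

lemma laurent_commute:
  assumes comm: "\<And>f g. \<lbrakk>f \<in> carrier A; g \<in> carrier A\<rbrakk> \<Longrightarrow> f \<otimes> g = g \<otimes> f"
    and fg: "f \<in> carrier Q" "g \<in> carrier Q"
  shows "f \<otimes>\<^bsub>Q\<^esub> g = g \<otimes>\<^bsub>Q\<^esub> f"
proof (rule series_eqI[of v])
  fix m
  obtain N where N: "\<forall>i<N. coeff_at v i f = 0" using lower_bound[OF fg(1)] by blast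
  obtain M where M: "\<forall>i<M. coeff_at v i g = 0" using lower_bound[OF fg(2)] by blast
  have "coeff_at v i f \<otimes> coeff_at v j g = coeff_at v j g \<otimes> coeff_at v i f" for i j
    using fg by (intro comm) (simp_all add: laurent_ring_def)
  then show "coeff_at v m (f \<otimes>\<^bsub>Q\<^esub> g) = coeff_at v m (g \<otimes>\<^bsub>Q\<^esub> f)"
    unfolding laurent_coeff_mult[OF fg(1) N fg(2) M] laurent_coeff_mult[OF fg(2) M fg(1) N]
    by (intro sum.reindex_bij_witness[of _ "\<lambda>i. m - i" "\<lambda>i. m - i"]) auto
qed

end

text \<open>
  \<open>\<partial>/\<partial>v\<close> on \<open>A((v))\<close>: it shifts the exponents, and the product rule for the coefficient of \<open>v\<^sup>m\<close> is the
  identity \<open>m + 1 = i + (m + 1 - i)\<close> in each term \<open>a\<^sub>i b\<^bsub>m+1-i\<^esub>\<close>.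
\<close>

lemma (in laurent_extension) partial_x_laurent_same:
  assumes v: "v = Xvar j"
  shows "derivation_on Q (insert v S) (partial_x j)"
proof -
  interpret Q: series_algebra Q "insert v S" by (rule laurent_series_algebra)
  note coeff = coeff_at_partial_x_same[of j, folded v]
  have closed: "partial_x j f \<in> carrier Q" if f: "f \<in> carrier Q" for f
  proof -
    obtain N where "\<forall>i<N. coeff_at v i f = 0" using lower_bound[OF f] by blast
    then have "\<forall>i < N - 1. coeff_at v i (partial_x j f) = 0"
      by (simp add: coeff)
    then show ?thesis
      using f unfolding laurent_ring_def by (auto simp: coeff zero_series_eq)
  qed
  show ?thesis
  proof
    fix f g assume f: "f \<in> carrier Q" and g: "g \<in> carrier Q"
    show "partial_x j (f \<otimes>\<^bsub>Q\<^esub> g) = partial_x j f \<otimes>\<^bsub>Q\<^esub> g + f \<otimes>\<^bsub>Q\<^esub> partial_x j g"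
    proof (rule series_eqI[of v])
      fix m
      have cl: "coeff_at v i f \<in> carrier A" "coeff_at v i g \<in> carrier A" for i
        using f g by (simp_all add: laurent_ring_def)
      let ?t = "\<lambda>i. coeff_at v i f \<otimes> coeff_at v (m + 1 - i) g"
      obtain N where N: "\<forall>i<N. coeff_at v i f = 0" using lower_bound[OF f] by blast
      obtain M where M: "\<forall>i<M. coeff_at v i g = 0" using lower_bound[OF g] by blast
      have N': "\<forall>i<N - 1. coeff_at v i (partial_x j f) = 0"
        and M': "\<forall>i<M - 1. coeff_at v i (partial_x j g) = 0"
        using N M by (simp_all add: coeff)
      have df: "coeff_at v m (partial_x j f \<otimes>\<^bsub>Q\<^esub> g) = (\<Sum>i=N..m + 1 - M. of_int i \<cdot> ?t i)"
        unfolding laurent_coeff_mult[OF closed[OF f] N' g M]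
        by (rule sum.reindex_bij_witness[of _ "\<lambda>i. i - 1" "\<lambda>i. i + 1"])
          (auto simp: coeff scale_mult cl)
      have dg: "coeff_at v m (f \<otimes>\<^bsub>Q\<^esub> partial_x j g) = (\<Sum>i=N..m + 1 - M. of_int (m + 1 - i) \<cdot> ?t i)"
        unfolding laurent_coeff_mult[OF f N closed[OF g] M']
        by (rule sum.cong) (auto simp: coeff mult_scale cl algebra_simps)
      have "coeff_at v m (partial_x j (f \<otimes>\<^bsub>Q\<^esub> g)) = (\<Sum>i=N..m + 1 - M. of_int (m + 1) \<cdot> ?t i)"
        unfolding coeff laurent_coeff_mult[OF f N g M] by (simp only: scale_series_sum)
      also have "\<dots> = (\<Sum>i=N..m + 1 - M. of_int i \<cdot> ?t i + of_int (m + 1 - i) \<cdot> ?t i)"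
        by (intro sum.cong) (auto simp: fun_eq_iff series_apply algebra_simps)
      finally show "coeff_at v m (partial_x j (f \<otimes>\<^bsub>Q\<^esub> g)) =
        coeff_at v m (partial_x j f \<otimes>\<^bsub>Q\<^esub> g + f \<otimes>\<^bsub>Q\<^esub> partial_x j g)"
        by (simp only: coeff_at_add df dg sum.distrib)
    qed
  qed (simp_all add: closed partial_x_add partial_x_scale)
qed

section \<open>The tower of iterated series rings\<close>

lemma const_series_algebra: "series_algebra (const_ring :: 'k::field_char_0 series ring) {}"
proof
  fix f :: "'k series" and v and e :: "symb \<Rightarrow> int"
  assume "f \<in> carrier const_ring" "e v \<noteq> 0"
  moreover from this have "e \<noteq> (\<lambda>_. 0)" by auto
  ultimately show "f e = 0"
    by (simp add: const_ring_def)
qed (auto simp: const_ring_def one_series_def series_apply fun_eq_iff algebra_simps)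

text \<open>
  \<open>partial_x\<close> shifts the exponent of \<open>x\<^sub>j\<close> from \<open>0\<close> to \<open>-1\<close>, where its factor is \<open>0\<close>.
\<close>

lemma const_derivation: "derivation_on (const_ring :: 'k::field_char_0 series ring) {} (partial_x j)"
proof -
  interpret series_algebra "const_ring :: 'k series ring" "{}" by (rule const_series_algebra)
  have zero: "partial_x j f = 0" if "f \<in> carrier const_ring" for f :: "'k series"
  proof
    fix e
    have "f (e(Xvar j := e (Xvar j) + 1)) = 0" if "e (Xvar j) + 1 \<noteq> 0"
      by (rule independent[of _ "Xvar j"]) (use that \<open>f \<in> carrier const_ring\<close> in auto)
    then show "partial_x j f e = 0 e"
      unfolding partial_x_def zero_fun_apply
      by (cases "e (Xvar j) + 1 = 0")
        (simp_all only: of_int_0 mult_zero_left mult_zero_right not_False_eq_True)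
  qed
  show ?thesis
    by unfold_locales (simp_all add: zero)
qed

lemma const_commute: "f \<otimes>\<^bsub>const_ring\<^esub> g = g \<otimes>\<^bsub>const_ring\<^esub> f"
  by (auto simp: const_ring_def fun_eq_iff)

text \<open>
  The variable \<open>x\<^sub>j\<close> may lie above level \<open>m\<close>: the derivation is then zero, but the induction treats
  it like any other one that acts on coefficients.
\<close>

lemma laurent_tower_derivation:
  "derivation_on (laurent_tower m :: 'k::field_char_0 series ring) (Xvar ` {1..m}) (partial_x j)"
proof (induction m arbitrary: j)
  case 0
  show ?case using const_derivation by simp
next
  case (Suc m)
  interpret derivation_on "laurent_tower m :: 'k series ring" "Xvar ` {1..m}" "partial_x j" by (rule Suc)
  interpret laurent_extension "laurent_tower m :: 'k series ring" "Xvar ` {1..m}" "Xvar (Suc m)"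
    by unfold_locales auto
  have "insert (Xvar (Suc m)) (Xvar ` {1..m}) = Xvar ` {1..Suc m}"
    by (auto simp: atLeastAtMostSuc_conv)
  then show ?case
    using partial_x_laurent_other[OF Suc, of j] partial_x_laurent_same[of j] by (cases "j = Suc m") auto
qed

lemma laurent_tower_commute:
  fixes f g :: "'k::field_char_0 series"
  shows "\<lbrakk>f \<in> carrier (laurent_tower m); g \<in> carrier (laurent_tower m)\<rbrakk> \<Longrightarrow>
    f \<otimes>\<^bsub>laurent_tower m\<^esub> g = g \<otimes>\<^bsub>laurent_tower m\<^esub> f"
proof (induction m arbitrary: f g)
  case (Suc m)
  interpret derivation_on "laurent_tower m :: 'k series ring" "Xvar ` {1..m}" "partial_x 0" by (rule laurent_tower_derivation)
  interpret laurent_extension "laurent_tower m :: 'k series ring" "Xvar ` {1..m}" "Xvar (Suc m)"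
    by unfold_locales auto
  show ?case
    using Suc.prems unfolding laurent_tower.simps by (intro laurent_commute[OF Suc.IH])
qed (simp add: const_commute)

definition tower_symbols :: "nat \<Rightarrow> nat \<Rightarrow> symb set" where
  "tower_symbols n i = Xvar ` {1..n} \<union> Dvar ` {1..i}"

lemma tower_symbols_Suc: "tower_symbols n (Suc i) = insert (Dvar (Suc i)) (tower_symbols n i)"
  by (auto simp: tower_symbols_def atLeastAtMostSuc_conv)

lemma Dvar_fresh: "Dvar (Suc i) \<notin> tower_symbols n i"
  by (auto simp: tower_symbols_def)

lemma pseudodiff_tower_derivation:
  "derivation_on (pseudodiff_tower n i :: 'k::field_char_0 series ring) (tower_symbols n i) (partial_x j)"
proof (induction i arbitrary: j)
  case 0
  show ?case using laurent_tower_derivation by (simp add: tower_symbols_def)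
next
  case (Suc i)
  interpret derivation_on "pseudodiff_tower n i :: 'k series ring" "tower_symbols n i" "partial_x (Suc i)"
    by (rule Suc)
  interpret pseudodiff_extension "pseudodiff_tower n i :: 'k series ring" "tower_symbols n i" "partial_x (Suc i)" "Dvar (Suc i)"
    by unfold_locales (rule Dvar_fresh)
  show ?case
    unfolding pseudodiff_tower.simps tower_symbols_Suc
    by (intro coefficientwise_derivation Suc coeff_at_partial_x partial_x_commute) simp
qed

lemma pseudodiff_tower_extension:
  "pseudodiff_extension (pseudodiff_tower n i) (tower_symbols n i) (partial_x (Suc i)) (Dvar (Suc i))"
  by (intro pseudodiff_extension.intro pseudodiff_tower_derivation pseudodiff_extension_axioms.intro Dvar_fresh)

text \<open>
  The residue at level \<open>i\<close>: all \<open>x\<^sub>1, \<dots>, x\<^sub>n\<close> and those \<open>\<partial>\<^sub>j\<close> that have been adjoined so far.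
\<close>

definition tower_res :: "nat \<Rightarrow> nat \<Rightarrow> 'k series \<Rightarrow> 'k" where
  "tower_res n i f = f (\<lambda>v. if v \<in> tower_symbols n i then -1 else 0)"

lemma tower_res_add: "tower_res n i (f + g) = tower_res n i f + tower_res n i g"
  and tower_res_scale: "tower_res n i (c \<cdot> f) = c * tower_res n i f"
  for f g :: "'k::field_char_0 series"
  by (simp_all add: tower_res_def series_apply)

text \<open>
  The factor that \<open>\<partial>/\<partial>x\<^sub>j\<close> puts in front of the coefficient of \<open>x\<^sub>j\<^sup>-\<^sup>1\<close> is \<open>-1 + 1 = 0\<close>.
\<close>

lemma tower_res_partial_x: "j \<in> {1..n} \<Longrightarrow> tower_res n i (partial_x j f) = 0"
  by (simp add: tower_res_def partial_x_def tower_symbols_def)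

lemma tower_res_Suc: "tower_res n (Suc i) f = tower_res n i (coeff_at (Dvar (Suc i)) (-1) f)"
proof -
  have "(\<lambda>v. if v \<in> tower_symbols n (Suc i) then -1 else 0) =
    (\<lambda>v. if v \<in> tower_symbols n i then -1 else 0 :: int)(Dvar (Suc i) := -1)"
    by (auto simp: tower_symbols_Suc)
  then show ?thesis
    by (simp add: tower_res_def coeff_at_def Dvar_fresh)
qed

lemma tower_res_trace:
  fixes f g :: "'k::field_char_0 series"
  shows "\<lbrakk>i \<le> n; f \<in> carrier (pseudodiff_tower n i); g \<in> carrier (pseudodiff_tower n i)\<rbrakk> \<Longrightarrow>
    tower_res n i (f \<otimes>\<^bsub>pseudodiff_tower n i\<^esub> g) = tower_res n i (g \<otimes>\<^bsub>pseudodiff_tower n i\<^esub> f)"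
proof (induction i arbitrary: f g)
  case 0
  then show ?case by (simp add: laurent_tower_commute[of f n g])
next
  case (Suc i)
  interpret pseudodiff_extension "pseudodiff_tower n i :: 'k series ring" "tower_symbols n i" "partial_x (Suc i)" "Dvar (Suc i)"
    by (rule pseudodiff_tower_extension)
  show ?case
    unfolding tower_res_Suc pseudodiff_tower.simps
    by (rule trace_extension)
      (use Suc in \<open>auto simp: tower_res_add tower_res_scale tower_res_partial_x\<close>)
qed

section \<open>Formal derivatives along polynomial curves\<close>

context series_algebra
begin

text \<open>
  \<open>polynomial_curve F f f'\<close> says that \<open>F \<epsilon>\<close> is polynomial in \<open>\<epsilon>\<close>, with value \<open>f\<close> and derivative
  \<open>f'\<close> at \<open>\<epsilon> = 0\<close>. Building the polynomial from constants by sums and by multiplication with \<open>\<epsilon>\<close>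
  turns the product rule into an induction without any convolution of coefficients.
\<close>

inductive polynomial_curve :: "('k \<Rightarrow> 'k series) \<Rightarrow> 'k series \<Rightarrow> 'k series \<Rightarrow> bool" where
  const: "f \<in> carrier A \<Longrightarrow> polynomial_curve (\<lambda>_. f) f 0"
| add: "\<lbrakk>polynomial_curve F f f'; polynomial_curve G g g'\<rbrakk> \<Longrightarrow>
    polynomial_curve (\<lambda>\<epsilon>. F \<epsilon> + G \<epsilon>) (f + g) (f' + g')"
| times_parameter: "polynomial_curve F f f' \<Longrightarrow> polynomial_curve (\<lambda>\<epsilon>. \<epsilon> \<cdot> F \<epsilon>) 0 f"

lemma polynomial_curve_closed:
  assumes "polynomial_curve F f f'"
  shows "F \<epsilon> \<in> carrier A \<and> f \<in> carrier A \<and> f' \<in> carrier A"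
  using assms by induction auto

lemma polynomial_curve_line:
  "\<lbrakk>f \<in> carrier A; g \<in> carrier A\<rbrakk> \<Longrightarrow> polynomial_curve (\<lambda>\<epsilon>. f + \<epsilon> \<cdot> g) f g"
  using add[OF const[of f] times_parameter[OF const[of g]]] by simp

lemma polynomial_curve_mult_const:
  assumes "polynomial_curve G g g'" and f: "f \<in> carrier A"
  shows "polynomial_curve (\<lambda>\<epsilon>. f \<otimes> G \<epsilon>) (f \<otimes> g) (f \<otimes> g')"
  using assms(1)
proof induction
  case (const g)
  then show ?case using polynomial_curve.const f by simp
next
  case (add F g g' G h h')
  then have "(\<lambda>\<epsilon>. f \<otimes> (F \<epsilon> + G \<epsilon>)) = (\<lambda>\<epsilon>. f \<otimes> F \<epsilon> + f \<otimes> G \<epsilon>)"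
    "f \<otimes> (g + h) = f \<otimes> g + f \<otimes> h" "f \<otimes> (g' + h') = f \<otimes> g' + f \<otimes> h'"
    using f polynomial_curve_closed[OF add.hyps(1)] polynomial_curve_closed[OF add.hyps(2)]
    by (auto simp: mult_add)
  then show ?case using polynomial_curve.add[OF add.IH] by simp
next
  case (times_parameter F g g')
  then have "(\<lambda>\<epsilon>. f \<otimes> \<epsilon> \<cdot> F \<epsilon>) = (\<lambda>\<epsilon>. \<epsilon> \<cdot> (f \<otimes> F \<epsilon>))"
    using f polynomial_curve_closed[OF times_parameter.hyps] by (auto simp: mult_scale)
  then show ?case using polynomial_curve.times_parameter[OF times_parameter.IH] f by simp
qed

lemma polynomial_curve_mult:
  assumes "polynomial_curve F f f'" and G: "polynomial_curve G g g'"
  shows "polynomial_curve (\<lambda>\<epsilon>. F \<epsilon> \<otimes> G \<epsilon>) (f \<otimes> g) (f' \<otimes> g + f \<otimes> g')"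
  using assms(1)
proof induction
  case (const f)
  then show ?case
    using polynomial_curve_mult_const[OF G const] polynomial_curve_closed[OF G] by simp
next
  case (add F f f' H h h')
  note cl = polynomial_curve_closed[OF add.hyps(1)] polynomial_curve_closed[OF add.hyps(2)] polynomial_curve_closed[OF G]
  have "(\<lambda>\<epsilon>. (F \<epsilon> + H \<epsilon>) \<otimes> G \<epsilon>) = (\<lambda>\<epsilon>. F \<epsilon> \<otimes> G \<epsilon> + H \<epsilon> \<otimes> G \<epsilon>)"
    "(f + h) \<otimes> g = f \<otimes> g + h \<otimes> g"
    "(f' + h') \<otimes> g + (f + h) \<otimes> g' = (f' \<otimes> g + f \<otimes> g') + (h' \<otimes> g + h \<otimes> g')"
    using cl by (auto simp: add_mult add_ac)
  then show ?case using polynomial_curve.add[OF add.IH] by simp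
next
  case (times_parameter F f f')
  note cl = polynomial_curve_closed[OF times_parameter.hyps] polynomial_curve_closed[OF G]
  have "(\<lambda>\<epsilon>. (\<epsilon> \<cdot> F \<epsilon>) \<otimes> G \<epsilon>) = (\<lambda>\<epsilon>. \<epsilon> \<cdot> (F \<epsilon> \<otimes> G \<epsilon>))"
    using cl by (auto simp: scale_mult)
  then show ?case using polynomial_curve.times_parameter[OF times_parameter.IH] cl by simp
qed

text \<open>
  The link with \<open>has_derivative_along\<close>: a linear form along a polynomial curve is a polynomial over
  \<open>k\<close> whose derivative at \<open>0\<close> is the value of the form on the derivative of the curve.
\<close>

lemma polynomial_curve_functional:
  fixes \<tau> :: "'k series \<Rightarrow> 'k"
  assumes \<tau>: "\<And>f g. \<tau> (f + g) = \<tau> f + \<tau> g" "\<And>c f. \<tau> (c \<cdot> f) = c * \<tau> f"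
    and "polynomial_curve F f f'"
  shows "\<exists>p. (\<forall>\<epsilon>. \<tau> (F \<epsilon>) = poly p \<epsilon>) \<and> poly p 0 = \<tau> f \<and> poly (pderiv p) 0 = \<tau> f'"
  using assms(3)
proof induction
  have \<tau>_0: "\<tau> 0 = 0"
    using \<tau>(2)[of 0 0] by simp
  {
    case (const f)
    show ?case by (intro exI[of _ "[:\<tau> f:]"]) (simp add: \<tau>_0)
  next
    case (add F f f' G g g')
    then obtain p q where "\<And>\<epsilon>. \<tau> (F \<epsilon>) = poly p \<epsilon>" "poly p 0 = \<tau> f" "poly (pderiv p) 0 = \<tau> f'"
      "\<And>\<epsilon>. \<tau> (G \<epsilon>) = poly q \<epsilon>" "poly q 0 = \<tau> g" "poly (pderiv q) 0 = \<tau> g'"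
      by blast
    then show ?case by (intro exI[of _ "p + q"]) (simp add: \<tau> pderiv_add)
  next
    case (times_parameter F f f')
    then obtain p where "\<And>\<epsilon>. \<tau> (F \<epsilon>) = poly p \<epsilon>" "poly p 0 = \<tau> f"
      by blast
    then show ?case by (intro exI[of _ "pCons 0 p"]) (simp add: \<tau> \<tau>_0 pderiv_pCons)
  }
qed

text \<open>
  The curve \<open>F\<close> starts at \<open>f\<close> with velocity \<open>[B, f]\<close>. As \<open>[B, -]\<close> is a derivation, such curves are
  closed under products, hence an ordered monomial inherits the property from its factors.
\<close>

definition lax_curve :: "'k series \<Rightarrow> ('k \<Rightarrow> 'k series) \<Rightarrow> 'k series \<Rightarrow> bool" where
  "lax_curve B F f \<longleftrightarrow> polynomial_curve F f (B \<otimes> f - f \<otimes> B)"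

lemma lax_curve_one: "B \<in> carrier A \<Longrightarrow> lax_curve B (\<lambda>_. one_series) one_series"
  using polynomial_curve.const[OF one_closed] by (simp add: lax_curve_def)

lemma lax_curve_mult:
  assumes "lax_curve B F f" "lax_curve B G g" and B: "B \<in> carrier A"
  shows "lax_curve B (\<lambda>\<epsilon>. F \<epsilon> \<otimes> G \<epsilon>) (f \<otimes> g)"
proof -
  have f: "f \<in> carrier A" and g: "g \<in> carrier A"
    using assms polynomial_curve_closed unfolding lax_curve_def by blast+
  have sub: "(x - y) \<otimes> z = x \<otimes> z - y \<otimes> z" "z \<otimes> (x - y) = z \<otimes> x - z \<otimes> y"
    if "x \<in> carrier A" "y \<in> carrier A" "z \<in> carrier A" for x y z
    using that add_mult[of x "- y" z] mult_add[of z x "- y"] by (simp_all add: minus_mult mult_minus)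
  have "(B \<otimes> f - f \<otimes> B) \<otimes> g + f \<otimes> (B \<otimes> g - g \<otimes> B) = B \<otimes> (f \<otimes> g) - (f \<otimes> g) \<otimes> B"
    using f g B by (simp add: sub mult_assoc)
  moreover have "polynomial_curve (\<lambda>\<epsilon>. F \<epsilon> \<otimes> G \<epsilon>) (f \<otimes> g)
      ((B \<otimes> f - f \<otimes> B) \<otimes> g + f \<otimes> (B \<otimes> g - g \<otimes> B))"
    using assms by (intro polynomial_curve_mult) (simp_all add: lax_curve_def)
  ultimately show ?thesis
    by (simp add: lax_curve_def)
qed

lemma lax_curve_pow:
  assumes "lax_curve B F f" and B: "B \<in> carrier A"
  shows "lax_curve B (\<lambda>\<epsilon>. F \<epsilon> [^] (m::nat)) (f [^] m)"
  using lax_curve_mult[OF _ assms] by (induction m) (simp_all add: nat_pow_def one_eq lax_curve_one B)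

lemma lax_curve_ordered_monomial:
  assumes "\<And>i. i \<in> {1..j} \<Longrightarrow> lax_curve B (\<lambda>\<epsilon>. F \<epsilon> i) (L i)" and B: "B \<in> carrier A"
  shows "lax_curve B (\<lambda>\<epsilon>. ordered_monomial A (F \<epsilon>) l j) (ordered_monomial A L l j)"
  using assms(1) by (induction j) (auto simp: one_eq B intro!: lax_curve_one lax_curve_mult lax_curve_pow)

lemma ordered_monomial_closed:
  assumes "\<And>i. i \<in> {1..j} \<Longrightarrow> L i \<in> carrier A"
  shows "ordered_monomial A L l j \<in> carrier A"
proof -
  have "f [^] (m::nat) \<in> carrier A" if "f \<in> carrier A" for f m
    using that by (induction m) (simp_all add: nat_pow_def one_eq)
  then show ?thesis
    using assms by (induction j) (auto simp: one_eq)
qed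

end

section \<open>Conservation of the residues\<close>

lemma plus_part_closed:
  fixes f :: "'k::field_char_0 series"
  assumes "n \<ge> 1" "f \<in> carrier (PDO n)"
  shows "plus_part n f \<in> carrier (PDO n)"
proof -
  obtain i where n: "n = Suc i"
    using assms(1) by (cases n) auto
  interpret pseudodiff_extension "pseudodiff_tower n i :: 'k series ring" "tower_symbols n i" "partial_x n" "Dvar n"
    using pseudodiff_tower_extension[of n i] by (simp add: n)
  have P: "PDO n = P"
    by (simp add: PDO_def n)
  have coeff: "coeff_at (Dvar n) j (plus_part n f) = (if j \<ge> 0 then coeff_at (Dvar n) j f else 0)" for j
    by (auto simp: coeff_at_def plus_part_def fun_eq_iff series_apply)
  show ?thesis
    using assms(2) unfolding P carrier_P order_le_def by (auto simp: coeff)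
qed

lemma PDO_series_algebra: "series_algebra (PDO n) (tower_symbols n n)"
  using pseudodiff_tower_derivation[of n n] unfolding PDO_def derivation_on_def by blast

lemma res_trace:
  "\<lbrakk>f \<in> carrier (PDO n); g \<in> carrier (PDO n)\<rbrakk> \<Longrightarrow> res n (f \<otimes>\<^bsub>PDO n\<^esub> g) = res n (g \<otimes>\<^bsub>PDO n\<^esub> f)"
  using tower_res_trace[of n n f g] by (simp add: PDO_def res_def tower_res_def tower_symbols_def)

theorem proposition6:
  fixes n :: nat and l :: "nat \<Rightarrow> nat"
  assumes "n \<ge> 1"
  shows "integral_of_motion n
           (hamiltonian n l :: (nat \<Rightarrow> 'k::field_char_0 series) \<Rightarrow> 'k)"
  unfolding integral_of_motion_def
proof (intro allI ballI)
  fix m :: "nat \<Rightarrow> nat" and L :: "nat \<Rightarrow> 'k series"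
  assume "L \<in> PDO_tuples n"
  then have L: "L i \<in> carrier (PDO n)" if "i \<in> {1..n}" for i
    using that by (auto simp: PDO_tuples_def)
  interpret series_algebra "PDO n :: 'k series ring" "tower_symbols n n"
    by (rule PDO_series_algebra)
  define B where "B = plus_part n (ordered_monomial (PDO n) L m n)"
  have B: "B \<in> carrier (PDO n)"
    unfolding B_def using assms L by (intro plus_part_closed ordered_monomial_closed)
  define V where "V = flow_field n m L"
  have V: "V i = B \<otimes>\<^bsub>PDO n\<^esub> L i - L i \<otimes>\<^bsub>PDO n\<^esub> B" if "i \<in> {1..n}" for i
    using that B L by (simp add: V_def flow_field_def B_def[symmetric] commutator_eq)
  define F where "F \<epsilon> = (\<lambda>i\<in>{1..n}. L i \<oplus>\<^bsub>PDO n\<^esub> \<epsilon> \<cdot> V i)" for \<epsilon>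
  have "lax_curve B (\<lambda>\<epsilon>. F \<epsilon> i) (L i)" if "i \<in> {1..n}" for i
    using that L[OF that] B polynomial_curve_line[of "L i" "V i"]
    by (simp add: F_def lax_curve_def V add_eq add_series_eq)
  then have curve: "lax_curve B (\<lambda>\<epsilon>. ordered_monomial (PDO n) (F \<epsilon>) l n) (ordered_monomial (PDO n) L l n)"
    using B by (rule lax_curve_ordered_monomial)
  have res_linear: "res n (f + g) = res n f + res n g" "res n (c \<cdot> f) = c * res n f" for f g :: "'k series" and c
    by (simp_all add: res_def series_apply)
  obtain p where p: "\<forall>\<epsilon>. hamiltonian n l (F \<epsilon>) = poly p \<epsilon>" and
    deriv: "poly (pderiv p) 0 = res n (B \<otimes>\<^bsub>PDO n\<^esub> ordered_monomial (PDO n) L l n -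
        ordered_monomial (PDO n) L l n \<otimes>\<^bsub>PDO n\<^esub> B)"
    using polynomial_curve_functional[of "res n", OF res_linear curve[unfolded lax_curve_def]]
    unfolding hamiltonian_def by blast
  have "res n (B \<otimes>\<^bsub>PDO n\<^esub> ordered_monomial (PDO n) L l n) =
      res n (ordered_monomial (PDO n) L l n \<otimes>\<^bsub>PDO n\<^esub> B)"
    using L by (intro res_trace B ordered_monomial_closed)
  then have "poly (pderiv p) 0 = 0"
    unfolding deriv by (simp add: res_def)
  with p show "has_derivative_along n (hamiltonian n l) L (flow_field n m L) 0"
    unfolding has_derivative_along_def F_def V_def by blast
qed

end
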